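(* Fix any $\varepsilon\in[0,1)$ and consider the curved Sitnikov problem with $R=1$ and parameter $r\in\left(0,\frac{2}{1+\varepsilon}\right)$ (the semi-major axis of the Keplerian ellipses traced out by the primaries), as described in the context. As $r$ approaches $\frac{2}{1+\varepsilon}$, the distance between a Keplerian ellipse and the circle of the massless particle approaches zero. There exists a sequence $r_n\uparrow\frac{2}{1+\varepsilon}$ satisfying $$r_0\le r_1<r_2\le r_3<\cdots<r_{2n}\le r_{2n+1}<\cdots$$ such that the equilibrium point $(q,p)=(\pi,0)$ of the linearized equation $$\dot x=y,\qquad \dot y=\frac{\partial f_\varepsilon}{\partial q}(\pi,t;r)\,x$$ is strongly stable for $r\in(r_{2n-1},r_{2n})$, for every $n\ge1$, and is not strongly stable for some $r$ in each of the complementary intervals $[r_{2n},r_{2n+1}]$. In other words, the equilibrium point $(\pi,0)$ loses and then regains its strong stability infinitely many times as $r$ increases towards $\frac{2}{1+\varepsilon}$.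
   Context: Curved Sitnikov problem with $R=1$: two primaries of equal mass have positions $$\mathbf x_1(t)=(r\rho\sin t,\,1+r\rho\cos t,\,0),\qquad \mathbf x_2(t)=(-r\rho\sin t,\,1-r\rho\cos t,\,0),$$ where $\rho=\rho(t;\varepsilon)=1-\varepsilon\cos u(t)$ and $u(t)$ (the eccentric anomaly) is the solution of Kepler's equation $u-\varepsilon\sin u=t$; the period is normalized to $2\pi$. The orbits of the primaries are referred to as the Keplerian ellipses. A massless particle is confined to the circle $\{(0,\cos q,\sin q)\}$ in the $yz$-plane, and its angular coordinate satisfies $\dot q=p$, $\dot p=f_\varepsilon(q,t;r)$, where $$f_\varepsilon(q,t;r)=-\frac{(1+r\rho\cos t)\sin q}{\left[r^2\rho^2+2(1-\cos q)(1+r\rho\cos t)\right]^{3/2}}-\frac{(1-r\rho\cos t)\sin q}{\left[r^2\rho^2+2(1-\cos q)(1-r\rho\cos t)\right]^{3/2}}.$$ The point $(\pi,0)$ is an equilibrium. Strongly stable means that the Floquet multipliers (eigenvalues of the monodromy matrix over the period $2\pi$) of the linearized equation at the equilibrium lie on the unit circle and are not real; equivalently, the linearized system lies in the interior of the set of stable systems. *)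

theory Defs
  imports "HOL-Analysis.Analysis"
begin

definition eccentric_anomaly :: "real \<Rightarrow> real \<Rightarrow> real" where
  "eccentric_anomaly \<epsilon> t = (THE u. u - \<epsilon> * sin u = t)"

lemma kepler_equation_ex1:
  fixes \<epsilon> t :: real
  assumes "0 \<le> \<epsilon>" and "\<epsilon> < 1"
  shows "\<exists>!u. u - \<epsilon> * sin u = t"
proof -
  let ?k = "\<lambda>u. u - \<epsilon> * sin u"
  have bound: "\<bar>\<epsilon> * sin x\<bar> \<le> 1" for x
    using assms by (simp add: abs_mult mult_le_one)
  have "\<exists>u. t - 1 \<le> u \<and> u \<le> t + 1 \<and> ?k u = t"
  proof (rule IVT')
    show "?k (t - 1) \<le> t" using bound[of "t - 1"] by linarith
    show "t \<le> ?k (t + 1)" using bound[of "t + 1"] by linarith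
    show "continuous_on {t - 1..t + 1} ?k" by (intro continuous_intros)
  qed simp
  moreover have less: "?k a < ?k b" if "a < b" for a b
  proof (rule DERIV_pos_imp_increasing[OF that])
    fix x :: real
    have "\<epsilon> * cos x \<le> \<epsilon> * 1"
      using assms by (intro mult_left_mono) auto
    then have "0 < 1 - \<epsilon> * cos x" using assms by linarith
    moreover have "(?k has_real_derivative 1 - \<epsilon> * cos x) (at x)"
      by (auto intro!: derivative_eq_intros)
    ultimately show "\<exists>y. (?k has_real_derivative y) (at x) \<and> 0 < y" by blast
  qed
  have "u = v" if "?k u = t" "?k v = t" for u v
    using less[of u v] less[of v u] that by (cases u v rule: linorder_cases) auto
  ultimately show ?thesis by blast
qed

definition rho :: "real \<Rightarrow> real \<Rightarrow> real" where
  "rho \<epsilon> t = 1 - \<epsilon> * cos (eccentric_anomaly \<epsilon> t)"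

definition primary1 :: "real \<Rightarrow> real \<Rightarrow> real \<Rightarrow> real ^ 3" where
  "primary1 \<epsilon> r t = vector [r * rho \<epsilon> t * sin t, 1 + r * rho \<epsilon> t * cos t, 0]"

definition primary2 :: "real \<Rightarrow> real \<Rightarrow> real \<Rightarrow> real ^ 3" where
  "primary2 \<epsilon> r t = vector [- r * rho \<epsilon> t * sin t, 1 - r * rho \<epsilon> t * cos t, 0]"

definition particle_circle :: "(real ^ 3) set" where
  "particle_circle = range (\<lambda>q::real. vector [0, cos q, sin q])"

text \<open>The acceleration \<open>f\<^sub>\<epsilon>(q, t; r)\<close> of the angular coordinate of the particle.\<close>

definition sitnikov_force :: "real \<Rightarrow> real \<Rightarrow> real \<Rightarrow> real \<Rightarrow> real" where
  "sitnikov_force \<epsilon> q t r =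
     - ((1 + r * rho \<epsilon> t * cos t) * sin q)
         / ((r\<^sup>2 * (rho \<epsilon> t)\<^sup>2 + 2 * (1 - cos q) * (1 + r * rho \<epsilon> t * cos t)) powr (3/2))
     - ((1 - r * rho \<epsilon> t * cos t) * sin q)
         / ((r\<^sup>2 * (rho \<epsilon> t)\<^sup>2 + 2 * (1 - cos q) * (1 - r * rho \<epsilon> t * cos t)) powr (3/2))"

text \<open>The coefficient matrix of \<open>x' = y\<close>, \<open>y' = \<partial>f\<^sub>\<epsilon>/\<partial>q(\<pi>, t; r) x\<close>.\<close>

definition linearization_matrix :: "real \<Rightarrow> real \<Rightarrow> real \<Rightarrow> real ^ 2 ^ 2" where
  "linearization_matrix \<epsilon> r t =
     vector [vector [0, 1],
             vector [deriv (\<lambda>q. sitnikov_force \<epsilon> q t r) pi, 0]]"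

definition fundamental_matrix :: "(real \<Rightarrow> real ^ 'n ^ 'n) \<Rightarrow> (real \<Rightarrow> real ^ 'n ^ 'n) \<Rightarrow> bool" where
  "fundamental_matrix A X \<longleftrightarrow>
     X 0 = mat 1 \<and> (\<forall>t. (X has_vector_derivative A t ** X t) (at t))"

definition monodromy_matrix :: "(real \<Rightarrow> real ^ 'n ^ 'n) \<Rightarrow> real \<Rightarrow> real ^ 'n ^ 'n \<Rightarrow> bool" where
  "monodromy_matrix A T M \<longleftrightarrow> (\<exists>X. fundamental_matrix A X \<and> M = X T)"

definition complex_eigenvalue :: "real ^ 'n ^ 'n \<Rightarrow> complex \<Rightarrow> bool" where
  "complex_eigenvalue M \<mu> \<longleftrightarrow>
     (\<exists>v :: complex ^ 'n. v \<noteq> 0 \<and> map_matrix complex_of_real M *v v = \<mu> *s v)"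

text \<open>For a system with continuous coefficients the monodromy matrix exists and is unique, so the
  existential quantifier below only names it.\<close>

definition strongly_stable :: "(real \<Rightarrow> real ^ 'n ^ 'n) \<Rightarrow> real \<Rightarrow> bool" where
  "strongly_stable A T \<longleftrightarrow>
     (\<exists>M. monodromy_matrix A T M \<and>
        (\<forall>\<mu>. complex_eigenvalue M \<mu> \<longrightarrow> cmod \<mu> = 1 \<and> \<mu> \<notin> \<real>))"

end

theory Submission
  imports Defs
begin

text \<open>
  Linearizing at \<open>q = \<pi>\<close> gives Hill's equation \<open>x'' = g\<^sub>r(t) x\<close>, where \<open>g\<^sub>r\<close> is continuous,
  \<open>2\<pi>\<close>-periodic and invariant under \<open>t \<mapsto> 2\<pi> - t\<close>.  The monodromy matrix has determinant 1, so strong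
  stability is governed by its trace \<open>\<tau>(r)\<close>: the multipliers are non-real and of modulus one if
  \<open>|\<tau>(r)| < 2\<close>, and one of them is \<open>\<plusminus>1\<close> if \<open>|\<tau>(r)| = 2\<close>.  As \<open>\<tau>\<close> is continuous, it is enough that
  \<open>\<tau>\<close> takes both values 2 and -2 at parameters arbitrarily close to \<open>2/(1+\<epsilon>)\<close>.  Between two such
  parameters the trace vanishes somewhere, which gives a stability interval, and the parameters
  themselves are not strongly stable (\<open>alternating_intervals\<close>).

  Because of the reflection symmetry, the trace over the full period is determined by the
  fundamental matrix over half a period: if \<open>x, u\<close> are the solutions with initial data \<open>(1,0)\<close> and
  \<open>(0,1)\<close>, then \<open>\<tau> = 2(x u' + u x')\<close> at time \<open>\<pi>\<close> (\<open>hill_trace_symmetric\<close>).  With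
  \<open>x u' - x' u = 1\<close> this equals -2 when \<open>x(\<pi>) = 0\<close> and 2 when \<open>x'(\<pi>) = 0\<close>.  So the vector
  \<open>(x(\<pi>), x'(\<pi>))\<close> has to cross both coordinate axes infinitely often, and for this it suffices that
  its angle, which depends continuously on \<open>r\<close>, is unbounded as \<open>r\<close> approaches the collision value.

  The angle grows because the near-collision acts as a very strong and very short attraction.  Put
  \<open>\<delta> = 2 - r(1+\<epsilon>)\<close>, the distance at time \<open>\<pi>\<close> between the first primary and the equilibrium.  For
  \<open>|t - \<pi>| \<le> \<delta>\<close> that distance is at most \<open>C\<delta>\<close>, with \<open>C\<close> depending only on \<open>\<epsilon>\<close>; hence, for small \<open>\<delta>\<close>,
  \<open>-g\<^sub>r(t) \<ge> \<omega>\<^sup>2\<close> with \<open>\<omega>\<close> of order \<open>\<delta>\<^bsup>-3/2\<^esup>\<close> (\<open>hill_coefficient_near_apoapsis\<close>).  In the Pruefer angle scaled by \<open>\<omega>\<close>, the solution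
  rotates at speed at least \<open>\<omega>\<close> during this time, which contributes \<open>\<delta>\<omega>\<close>, of order \<open>\<delta>\<^bsup>-1/2\<^esup>\<close>.  At all other
  times \<open>g\<^sub>r \<le> 2\<close>, so the angle loses at most \<open>2\<pi>/\<omega>\<close>, which stays bounded
  (\<open>pruefer_angle_lower_bound\<close>).

  Continuity in \<open>r\<close> of the solutions, and with them of trace and angle, comes out of their
  construction: \<open>global_solution_with_parameter\<close> runs the Picard fixed-point argument on functions of
  time and parameter simultaneously.
\<close>

section \<open>Differential equations on the line depending on a parameter\<close>

text \<open>
  The primitive \<open>\<integral>\<^sub>0\<^sup>t h\<close> rewritten over the fixed interval \<open>[0, 1]\<close>.  In this form it covers negative
  \<open>t\<close> as well, and its continuity in further parameters is a statement about an integral with constant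
  bounds.
\<close>

lemma scaled_integral_has_vector_derivative:
  fixes h :: "real \<Rightarrow> 'a::banach"
  assumes "continuous_on UNIV h"
  shows "((\<lambda>t. t *\<^sub>R integral {0..1} (\<lambda>\<sigma>. h (t * \<sigma>))) has_vector_derivative h t) (at t)"
proof -
  \<comment> \<open>Any interval with \<open>0\<close> and \<open>t\<close> in its interior.\<close>
  define N where "N = \<bar>t\<bar> + 1"
  obtain H where H: "\<And>x. x \<in> {-N..N} \<Longrightarrow> (H has_vector_derivative h x) (at x within {-N..N})"
    using antiderivative_continuous[of "-N" N h] assms continuous_on_subset by blast
  have H': "(H has_vector_derivative h x) (at x)" if "x \<in> {-N<..<N}" for x
    using H[of x] that by (simp add: at_within_interior[of x "{-N..N}"])
  have eq: "H s - H 0 = s *\<^sub>R integral {0..1} (\<lambda>\<sigma>. h (s * \<sigma>))" if s: "s \<in> {-N<..<N}" for s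
  proof -
    have in_range: "s * \<sigma> \<in> {-N<..<N}" if "\<sigma> \<in> {0..1}" for \<sigma>
    proof -
      have "\<bar>s * \<sigma>\<bar> \<le> \<bar>s\<bar> * 1"
        unfolding abs_mult using that by (intro mult_left_mono) auto
      then show ?thesis using s by auto
    qed
    have "((\<lambda>\<sigma>. s *\<^sub>R h (s * \<sigma>)) has_integral H (s * 1) - H (s * 0)) {0..1}"
    proof (rule fundamental_theorem_of_calculus)
      fix \<sigma> :: real assume \<sigma>: "\<sigma> \<in> {0..1}"
      have "((\<lambda>\<sigma>. s * \<sigma>) has_vector_derivative s) (at \<sigma>)"
        by (auto intro!: derivative_eq_intros)
      from vector_diff_chain_at[OF this H'[OF in_range[OF \<sigma>]]]
      show "((\<lambda>\<sigma>. H (s * \<sigma>)) has_vector_derivative s *\<^sub>R h (s * \<sigma>)) (at \<sigma> within {0..1})"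
        by (simp add: o_def has_vector_derivative_at_within)
    qed simp
    from integral_unique[OF this] show ?thesis by simp
  qed
  have t: "t \<in> {-N<..<N}" by (auto simp: N_def)
  have "((\<lambda>s. H s - H 0) has_vector_derivative h t) (at t)"
    using H'[OF t] by (auto intro!: derivative_eq_intros)
  then show ?thesis
    by (rule has_vector_derivative_transform_within_open[OF _ open_greaterThanLessThan t])
       (use eq in auto)
qed

text \<open>
  The estimate behind the weighted norm: integrating a function of growth \<open>exp (M|t|)\<close> gains the
  factor \<open>1/M\<close>, so a large weight turns the Picard operator into a contraction on the whole line.
\<close>

lemma norm_scaled_integral_le_exp:
  fixes h :: "real \<Rightarrow> 'a::banach"
  assumes h: "continuous_on UNIV h" and M: "0 < M"
    and bound: "\<And>\<tau>. norm (h \<tau>) \<le> C * exp (M * \<bar>\<tau>\<bar>)"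
  shows "norm (t *\<^sub>R integral {0..1} (\<lambda>\<sigma>. h (t * \<sigma>))) \<le> C / M * exp (M * \<bar>t\<bar>)"
proof -
  have C: "0 \<le> C" using bound[of 0] norm_ge_zero[of "h 0"] by (simp del: norm_ge_zero)
  have int: "((\<lambda>\<sigma>. C * \<bar>t\<bar> * exp (M * \<bar>t\<bar> * \<sigma>)) has_integral
        C / M * exp (M * \<bar>t\<bar> * 1) - C / M * exp (M * \<bar>t\<bar> * 0)) {0..1}"
  proof (rule fundamental_theorem_of_calculus)
    fix \<sigma> :: real
    have "((\<lambda>\<sigma>. C / M * exp (M * \<bar>t\<bar> * \<sigma>)) has_real_derivative C * \<bar>t\<bar> * exp (M * \<bar>t\<bar> * \<sigma>))
        (at \<sigma> within {0..1})"
      using M by (auto intro!: derivative_eq_intros)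
    then show "((\<lambda>\<sigma>. C / M * exp (M * \<bar>t\<bar> * \<sigma>)) has_vector_derivative
        C * \<bar>t\<bar> * exp (M * \<bar>t\<bar> * \<sigma>)) (at \<sigma> within {0..1})"
      by (simp add: has_real_derivative_iff_has_vector_derivative)
  qed simp
  have "continuous_on {0..1} (\<lambda>\<sigma>. h (t * \<sigma>))"
    by (intro continuous_on_compose2[OF h] continuous_intros) auto
  then have "(\<lambda>\<sigma>. t *\<^sub>R h (t * \<sigma>)) integrable_on {0..1}"
    by (intro integrable_continuous_interval continuous_intros)
  then have "norm (integral {0..1} (\<lambda>\<sigma>. t *\<^sub>R h (t * \<sigma>)))
      \<le> integral {0..1} (\<lambda>\<sigma>. C * \<bar>t\<bar> * exp (M * \<bar>t\<bar> * \<sigma>))"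
  proof (rule integral_norm_bound_integral)
    show "(\<lambda>\<sigma>. C * \<bar>t\<bar> * exp (M * \<bar>t\<bar> * \<sigma>)) integrable_on {0..1}"
      using int by blast
    fix \<sigma> :: real assume "\<sigma> \<in> {0..1}"
    then have "norm (h (t * \<sigma>)) \<le> C * exp (M * \<bar>t\<bar> * \<sigma>)"
      using bound[of "t * \<sigma>"] by (simp add: abs_mult mult.assoc)
    then have "\<bar>t\<bar> * norm (h (t * \<sigma>)) \<le> \<bar>t\<bar> * (C * exp (M * \<bar>t\<bar> * \<sigma>))"
      by (rule mult_left_mono) simp
    then show "norm (t *\<^sub>R h (t * \<sigma>)) \<le> C * \<bar>t\<bar> * exp (M * \<bar>t\<bar> * \<sigma>)"
      by (simp add: mult_ac)
  qed
  also have "\<dots> = C / M * exp (M * \<bar>t\<bar>) - C / M"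
    using integral_unique[OF int] by simp
  also have "\<dots> \<le> C / M * exp (M * \<bar>t\<bar>)"
    using C M by simp
  finally show ?thesis by simp
qed

text \<open>
  The Picard operator is a contraction for the norm \<open>sup |exp (-M(s)|t|) X(s, t)|\<close> with
  \<open>M = 2L + 1\<close>.  Taking the supremum over the parameter as well as over time puts the fixed point into a
  space of jointly continuous functions, so continuous dependence on the parameter needs no separate
  argument.  The weight absorbs that \<open>L\<close> may be unbounded.
\<close>

lemma global_solution_with_parameter:
  fixes f :: "'p::metric_space \<Rightarrow> real \<Rightarrow> 'a::banach \<Rightarrow> 'a"
  assumes cont: "continuous_on UNIV (\<lambda>(s, t, x). f s t x)"
    and L: "continuous_on UNIV L"
    and L_nonneg: "\<And>s. 0 \<le> L s"
    and lip: "\<And>s t x y. norm (f s t x - f s t y) \<le> L s * norm (x - y)"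
    and zero: "\<And>s t. f s t 0 = 0"
  obtains X where "\<And>s. X s 0 = x0"
    and "\<And>s t. (X s has_vector_derivative f s t (X s t)) (at t)"
    and "continuous_on UNIV (\<lambda>(s, t). X s t)"
proof -
  define M where "M s = 2 * L s + 1" for s
  have M_pos: "0 < M s" for s using L_nonneg[of s] by (simp add: M_def)
  have M_cont: "continuous_on A (\<lambda>x. M (g x))" if "continuous_on A g" for A and g :: "'b::topological_space \<Rightarrow> 'p"
  proof -
    have "continuous_on A (\<lambda>x. L (g x))"
      by (rule continuous_on_compose2[OF L that]) simp
    then show ?thesis unfolding M_def by (intro continuous_intros)
  qed
  have L_le: "L s / M s \<le> 1/2" for s
    using M_pos[of s] unfolding M_def by (simp add: divide_simps)
  have fcont: "continuous_on A (\<lambda>x. f (g x) (h x) (k x))"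
    if "continuous_on A g" "continuous_on A h" "continuous_on A k"
    for A h k and g :: "'b::topological_space \<Rightarrow> 'p"
  proof -
    have "continuous_on A (\<lambda>x. (g x, h x, k x))"
      by (intro continuous_on_Pair that)
    from continuous_on_compose2[OF cont this] show ?thesis by simp
  qed
  \<comment> \<open>\<open>w\<close> is the bounded rescaling of the unknown \<open>V w\<close>; \<open>J\<close> is the integral part of the Picard operator,
     and \<open>F\<close> is that operator in terms of \<open>w\<close>.\<close>
  define V where "V w s t = exp (M s * \<bar>t\<bar>) *\<^sub>R apply_bcontfun w (s, t)"
    for w :: "('p \<times> real) \<Rightarrow>\<^sub>C 'a" and s t
  define J where "J w s t = t *\<^sub>R integral {0..1} (\<lambda>\<sigma>. f s (t * \<sigma>) (V w s (t * \<sigma>)))" for w s t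
  have V_cont: "continuous_on A (\<lambda>x. V w (g x) (h x))"
    if "continuous_on A g" "continuous_on A h" for A w h and g :: "'b::topological_space \<Rightarrow> 'p"
  proof -
    have "continuous_on A (\<lambda>x. apply_bcontfun w (g x, h x))"
      by (rule continuous_on_compose2[OF continuous_on_apply_bcontfun[of UNIV w] continuous_on_Pair[OF that]]) simp
    then show ?thesis
      unfolding V_def by (intro continuous_intros M_cont[OF that(1)] that(2))
  qed
  have integrand_cont: "continuous_on UNIV (\<lambda>t. f s t (V w s t))" for w s
    by (rule fcont[OF continuous_on_const continuous_on_id V_cont[OF continuous_on_const continuous_on_id]])
  have J_cont: "continuous_on UNIV (\<lambda>(s, t). J w s t)" for w
  proof -
    have c1: "continuous_on (UNIV \<times> cbox 0 1) (\<lambda>q :: ('p \<times> real) \<times> real. fst (fst q))"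
      and c2: "continuous_on (UNIV \<times> cbox 0 1) (\<lambda>q :: ('p \<times> real) \<times> real. snd (fst q) * snd q)"
      by (intro continuous_intros)+
    have "continuous_on UNIV (\<lambda>p. integral (cbox 0 1) (\<lambda>\<sigma>. f (fst p) (snd p * \<sigma>) (V w (fst p) (snd p * \<sigma>))))"
      by (rule integral_continuous_on_param, unfold case_prod_beta) (rule fcont[OF c1 c2 V_cont[OF c1 c2]])
    from continuous_on_scaleR[OF continuous_on_snd[OF continuous_on_id] this] show ?thesis
      by (simp add: J_def case_prod_beta)
  qed
  have J_diff: "norm (J w s t - J w' s t) \<le> dist w w' / 2 * exp (M s * \<bar>t\<bar>)" for w w' s t
  proof -
    have integrable: "(\<lambda>\<sigma>. f s (t * \<sigma>) (V w s (t * \<sigma>))) integrable_on {0..1}" for w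
    proof (rule integrable_continuous_interval)
      have c: "continuous_on {0..1} (\<lambda>\<sigma>. t * \<sigma>)" by (intro continuous_intros)
      show "continuous_on {0..1} (\<lambda>\<sigma>. f s (t * \<sigma>) (V w s (t * \<sigma>)))"
        by (rule fcont[OF continuous_on_const c V_cont[OF continuous_on_const c]])
    qed
    have "norm (J w s t - J w' s t) = norm (t *\<^sub>R integral {0..1}
        (\<lambda>\<sigma>. f s (t * \<sigma>) (V w s (t * \<sigma>)) - f s (t * \<sigma>) (V w' s (t * \<sigma>))))"
      unfolding J_def integral_diff[OF integrable integrable] scaleR_diff_right ..
    also have "\<dots> \<le> (L s * dist w w') / M s * exp (M s * \<bar>t\<bar>)"
    proof (rule norm_scaled_integral_le_exp[OF continuous_on_diff[OF integrand_cont integrand_cont] M_pos])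
      fix \<tau>
      have "norm (f s \<tau> (V w s \<tau>) - f s \<tau> (V w' s \<tau>)) \<le> L s * norm (V w s \<tau> - V w' s \<tau>)"
        by (rule lip)
      also have "\<dots> = L s * (dist (apply_bcontfun w (s, \<tau>)) (apply_bcontfun w' (s, \<tau>)) * exp (M s * \<bar>\<tau>\<bar>))"
        by (simp add: V_def dist_norm flip: scaleR_diff_right)
      also have "\<dots> \<le> L s * (dist w w' * exp (M s * \<bar>\<tau>\<bar>))"
        by (intro mult_left_mono mult_right_mono dist_bounded L_nonneg) simp
      finally show "norm (f s \<tau> (V w s \<tau>) - f s \<tau> (V w' s \<tau>)) \<le> L s * dist w w' * exp (M s * \<bar>\<tau>\<bar>)"
        by simp
    qed
    also have "\<dots> \<le> dist w w' / 2 * exp (M s * \<bar>t\<bar>)"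
      using mult_right_mono[OF L_le[of s], of "dist w w'"]
      by (intro mult_right_mono) simp_all
    finally show ?thesis .
  qed
  define F where "F w p = exp (- M (fst p) * \<bar>snd p\<bar>) *\<^sub>R (x0 + J w (fst p) (snd p))" for w p
  have J_zero: "J 0 s t = 0" for s t
    by (simp add: J_def V_def zero)
  have F_bcontfun: "F w \<in> bcontfun" for w
  proof (rule bcontfun_normI)
    have "continuous_on UNIV (\<lambda>p. J w (fst p) (snd p))"
      using J_cont by (simp add: case_prod_beta)
    then show "continuous_on UNIV (F w)"
      unfolding F_def by (intro continuous_intros M_cont[OF continuous_on_fst[OF continuous_on_id]])
    fix p
    have "norm (F w p) \<le> exp (- M (fst p) * \<bar>snd p\<bar>) * (norm x0 + norm (J w (fst p) (snd p)))"
      by (simp add: F_def norm_triangle_ineq)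
    also have "\<dots> \<le> exp (- M (fst p) * \<bar>snd p\<bar>) * (norm x0 + norm w / 2 * exp (M (fst p) * \<bar>snd p\<bar>))"
      using J_diff[of w "fst p" "snd p" 0] by (simp add: J_zero)
    also have "\<dots> = exp (- M (fst p) * \<bar>snd p\<bar>) * norm x0 + norm w / 2"
      by (simp add: algebra_simps flip: exp_add)
    also have "\<dots> \<le> 1 * norm x0 + norm w / 2"
      using M_pos[of "fst p"] by (intro add_right_mono mult_right_mono) auto
    finally show "norm (F w p) \<le> norm x0 + norm w / 2" by simp
  qed
  define \<Phi> where "\<Phi> w = Bcontfun (F w)" for w
  have \<Phi>: "apply_bcontfun (\<Phi> w) = F w" for w
    by (simp add: \<Phi>_def Bcontfun_inverse F_bcontfun)
  have "\<exists>!w. \<Phi> w = w"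
  proof (rule banach_fix_type)
    show "\<forall>w w'. dist (\<Phi> w) (\<Phi> w') \<le> 1/2 * dist w w'"
    proof (intro allI dist_bound)
      fix w w' p
      have "dist (F w p) (F w' p) = exp (- M (fst p) * \<bar>snd p\<bar>) * norm (J w (fst p) (snd p) - J w' (fst p) (snd p))"
        by (simp add: F_def dist_norm flip: scaleR_diff_right)
      also have "\<dots> \<le> exp (- M (fst p) * \<bar>snd p\<bar>) * (dist w w' / 2 * exp (M (fst p) * \<bar>snd p\<bar>))"
        by (intro mult_left_mono J_diff) simp
      also have "\<dots> = 1/2 * dist w w'"
        by (simp flip: exp_add)
      finally show "dist (apply_bcontfun (\<Phi> w) p) (apply_bcontfun (\<Phi> w') p) \<le> 1/2 * dist w w'"
        by (simp add: \<Phi>)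
    qed
  qed auto
  then obtain w where w: "\<Phi> w = w" by blast
  have V_eq: "V w s t = x0 + J w s t" for s t
  proof -
    have "apply_bcontfun w (s, t) = F w (s, t)" using \<Phi>[of w] w by simp
    then show ?thesis by (simp add: V_def F_def flip: exp_add)
  qed
  show ?thesis
  proof
    show "V w s 0 = x0" for s
    proof -
      have "J w s 0 = 0" by (simp add: J_def)
      then show ?thesis unfolding V_eq by simp
    qed
    show "(V w s has_vector_derivative f s t (V w s t)) (at t)" for s t
    proof -
      have "(J w s has_vector_derivative f s t (V w s t)) (at t)"
        unfolding J_def by (rule scaled_integral_has_vector_derivative[OF integrand_cont])
      then have "((\<lambda>t. x0 + J w s t) has_vector_derivative f s t (V w s t)) (at t)"
        by (auto intro!: derivative_eq_intros)
      moreover have "V w s = (\<lambda>t. x0 + J w s t)" using V_eq by blast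
      ultimately show ?thesis by simp
    qed
    show "continuous_on UNIV (\<lambda>(s, t). V w s t)"
      unfolding case_prod_beta 
      by (rule V_cont[OF continuous_on_fst[OF continuous_on_id] continuous_on_snd[OF continuous_on_id]])
  qed
qed

lemma second_order_solution_with_parameter:
  fixes g :: "'p::metric_space \<Rightarrow> real \<Rightarrow> real"
  assumes g: "continuous_on UNIV (\<lambda>(s, t). g s t)"
    and K: "continuous_on UNIV K" "\<And>s t. \<bar>g s t\<bar> \<le> K s"
  obtains x y where "\<And>s. x s 0 = a" "\<And>s. y s 0 = b"
    and "\<And>s t. (x s has_real_derivative y s t) (at t)"
    and "\<And>s t. (y s has_real_derivative g s t * x s t) (at t)"
    and "continuous_on UNIV (\<lambda>(s, t). x s t)" "continuous_on UNIV (\<lambda>(s, t). y s t)"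
proof -
  define f where "f s t z = (snd z, g s t * fst z)" for s t and z :: "real \<times> real"
  have K0: "0 \<le> K s" for s using K(2)[of s 0] by linarith
  have pair: "continuous_on UNIV (\<lambda>p :: 'p \<times> real \<times> real \<times> real. (fst p, fst (snd p)))"
    by (intro continuous_intros)
  have "continuous_on UNIV (\<lambda>p :: 'p \<times> real \<times> real \<times> real. g (fst p) (fst (snd p)))"
    using continuous_on_compose2[OF g pair] by simp
  then have f_cont: "continuous_on UNIV (\<lambda>(s, t, z). f s t z)"
    unfolding f_def case_prod_beta by (intro continuous_intros)
  have L_cont: "continuous_on UNIV (\<lambda>s. 1 + K s)" by (intro continuous_intros K)
  have L_nonneg: "0 \<le> 1 + K s" for s using K0[of s] by simp
  have lip: "norm (f s t z - f s t z') \<le> (1 + K s) * norm (z - z')" for s t z z'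
  proof -
    have "f s t z - f s t z' = (snd (z - z'), g s t * fst (z - z'))"
      by (simp add: f_def right_diff_distrib)
    then have "norm (f s t z - f s t z') \<le> norm (snd (z - z')) + \<bar>g s t\<bar> * norm (fst (z - z'))"
      using norm_Pair_le[of "snd (z - z')" "g s t * fst (z - z')"] by (simp add: abs_mult)
    also have "\<dots> \<le> norm (z - z') + K s * norm (z - z')"
      using norm_fst_le[of "fst (z - z')" "snd (z - z')"] norm_snd_le[of "snd (z - z')" "fst (z - z')"]
      by (intro add_mono mult_mono K K0) (simp_all only: prod.collapse norm_ge_zero)
    finally show ?thesis by (simp add: algebra_simps)
  qed
  have zero: "f s t 0 = 0" for s t by (simp add: f_def zero_prod_def)
  obtain X where X: "\<And>s. X s 0 = (a, b)"
    and X': "\<And>s t. (X s has_vector_derivative f s t (X s t)) (at t)"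
    and Xc: "continuous_on UNIV (\<lambda>(s, t). X s t)"
    using global_solution_with_parameter[OF f_cont L_cont L_nonneg lip zero, of "(a, b)"] by blast
  show ?thesis
  proof
    show "fst (X s 0) = a" "snd (X s 0) = b" for s by (simp_all add: X)
    show "((\<lambda>t. fst (X s t)) has_real_derivative snd (X s t)) (at t)" for s t
      using bounded_linear.has_vector_derivative[OF bounded_linear_fst X'[of s t]]
      by (simp add: has_real_derivative_iff_has_vector_derivative f_def)
    show "((\<lambda>t. snd (X s t)) has_real_derivative g s t * fst (X s t)) (at t)" for s t
      using bounded_linear.has_vector_derivative[OF bounded_linear_snd X'[of s t]]
      by (simp add: has_real_derivative_iff_has_vector_derivative f_def)
    show "continuous_on UNIV (\<lambda>(s, t). fst (X s t))" "continuous_on UNIV (\<lambda>(s, t). snd (X s t))"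
      using continuous_on_fst[OF Xc] continuous_on_snd[OF Xc] by (simp_all add: case_prod_beta)
  qed
qed

text \<open>
  The bound \<open>K\<close> may blow up at the ends of the interval \<open>(0, c)\<close>, and then nothing extends to the whole
  line; the logistic bijection between \<open>\<real>\<close> and \<open>(0, c)\<close> transports the parameter instead.
\<close>

lemma second_order_solution_on_interval:
  fixes g :: "real \<Rightarrow> real \<Rightarrow> real"
  assumes "0 < c" and g: "continuous_on ({0<..<c} \<times> UNIV) (\<lambda>(r, t). g r t)"
    and K: "continuous_on {0<..<c} K" "\<And>r t. r \<in> {0<..<c} \<Longrightarrow> \<bar>g r t\<bar> \<le> K r"
  obtains x y where "\<And>r. r \<in> {0<..<c} \<Longrightarrow> x r 0 = a" "\<And>r. r \<in> {0<..<c} \<Longrightarrow> y r 0 = b"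
    and "\<And>r t. r \<in> {0<..<c} \<Longrightarrow> (x r has_real_derivative y r t) (at t)"
    and "\<And>r t. r \<in> {0<..<c} \<Longrightarrow> (y r has_real_derivative g r t * x r t) (at t)"
    and "continuous_on ({0<..<c} \<times> UNIV) (\<lambda>(r, t). x r t)"
    and "continuous_on ({0<..<c} \<times> UNIV) (\<lambda>(r, t). y r t)"
proof -
  define R where "R s = c * (exp s / (1 + exp s))" for s :: real
  define S where "S r = ln (r / (c - r))" for r :: real
  have pos: "0 < 1 + exp s" for s :: real by (simp add: add_pos_pos)
  have R: "R s \<in> {0<..<c}" for s
  proof -
    have "exp s / (1 + exp s) < 1" using pos[of s] by (subst divide_less_eq_1_pos) simp_all
    then have "c * (exp s / (1 + exp s)) < c * 1" using \<open>0 < c\<close> by (intro mult_strict_left_mono)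
    moreover have "0 < c * (exp s / (1 + exp s))"
      using pos[of s] \<open>0 < c\<close> by (intro mult_pos_pos divide_pos_pos) auto
    ultimately show ?thesis unfolding R_def by simp
  qed
  have RS: "R (S r) = r" if "r \<in> {0<..<c}" for r
  proof -
    have "exp (S r) = r / (c - r)" using that by (simp add: S_def)
    moreover have "1 + r / (c - r) = c / (c - r)" using that by (simp add: field_simps)
    ultimately show ?thesis using that by (simp add: R_def)
  qed
  have R_cont: "continuous_on UNIV R"
    unfolding R_def by (intro continuous_intros) (auto simp: pos less_imp_neq[THEN not_sym])
  have S_cont: "continuous_on {0<..<c} S"
    unfolding S_def by (intro continuous_intros) auto
  have "continuous_on UNIV (\<lambda>p. (R (fst p), snd p :: real))"
    by (intro continuous_intros continuous_on_compose2[OF R_cont]) auto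
  then have gR: "continuous_on UNIV (\<lambda>(s, t). g (R s) t)"
    using continuous_on_compose2[OF g, of UNIV "\<lambda>p. (R (fst p), snd p)"] R by (force simp: case_prod_beta)
  have KR: "continuous_on UNIV (\<lambda>s. K (R s))"
    by (rule continuous_on_compose2[OF K(1) R_cont]) (use R in blast)
  obtain x y where x: "\<And>s. x s 0 = a" "\<And>s. y s 0 = b"
    and x': "\<And>s t. (x s has_real_derivative y s t) (at t)"
    and y': "\<And>s t. (y s has_real_derivative g (R s) t * x s t) (at t)"
    and cont: "continuous_on UNIV (\<lambda>(s, t). x s t)" "continuous_on UNIV (\<lambda>(s, t). y s t)"
    using second_order_solution_with_parameter[OF gR KR K(2)[OF R], of a b] by blast
  have pull: "continuous_on ({0<..<c} \<times> UNIV) (\<lambda>(r, t). h (S r) t)"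
    if "continuous_on UNIV (\<lambda>(s, t). h s t)" for h :: "real \<Rightarrow> real \<Rightarrow> real"
  proof -
    have "continuous_on ({0<..<c} \<times> UNIV) (\<lambda>p. (S (fst p), snd p :: real))"
      by (intro continuous_intros continuous_on_compose2[OF S_cont]) auto
    from continuous_on_compose2[OF that this] show ?thesis by (simp add: case_prod_beta)
  qed
  have y'': "(y (S r) has_real_derivative g r t * x (S r) t) (at t)" if "r \<in> {0<..<c}" for r t
    using y'[of "S r" t] RS[OF that] by simp
  show ?thesis
    by (rule that[of "\<lambda>r. x (S r)" "\<lambda>r. y (S r)"])
       (use x x' y'' pull[OF cont(1)] pull[OF cont(2)] in simp_all)
qed

section \<open>Hill's equation and its multipliers\<close>

lemma wronskian_constant:
  fixes x y u v g :: "real \<Rightarrow> real"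
  assumes "\<And>t. (x has_real_derivative y t) (at t)" "\<And>t. (y has_real_derivative g t * x t) (at t)"
    and "\<And>t. (u has_real_derivative v t) (at t)" "\<And>t. (v has_real_derivative g t * u t) (at t)"
  shows "x s * v s - y s * u s = x t * v t - y t * u t"
proof (rule DERIV_isconst_all[rule_format, where f = "\<lambda>t. x t * v t - y t * u t"])
  fix t
  show "((\<lambda>t. x t * v t - y t * u t) has_real_derivative 0) (at t)"
    by (rule derivative_eq_intros assms refl)+ (simp add: algebra_simps)
qed

lemma cramer_2:
  fixes a b c d :: "'a::comm_ring_1"
  assumes "a * d - c * b = 1" "a * y - c * x = p" "b * y - d * x = q"
  shows "x = p * b - q * a" "y = p * d - q * c"
proof -
  have "p * b - q * a = (a * d - c * b) * x" "p * d - q * c = (a * d - c * b) * y"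
    unfolding assms(2,3)[symmetric] by (simp_all add: algebra_simps)
  then show "x = p * b - q * a" "y = p * d - q * c" using assms(1) by simp_all
qed

definition hill_matrix :: "(real \<Rightarrow> real) \<Rightarrow> real \<Rightarrow> real ^ 2 ^ 2" where
  "hill_matrix g t = vector [vector [0, 1], vector [g t, 0]]"

lemma fundamental_matrix_hillD:
  assumes "fundamental_matrix (hill_matrix g) X"
  shows "X 0 $ 1 $ 1 = 1" "X 0 $ 1 $ 2 = 0" "X 0 $ 2 $ 1 = 0" "X 0 $ 2 $ 2 = 1"
    and "((\<lambda>t. X t $ 1 $ j) has_real_derivative X t $ 2 $ j) (at t)"
    and "((\<lambda>t. X t $ 2 $ j) has_real_derivative g t * X t $ 1 $ j) (at t)"
proof -
  have X0: "X 0 = mat 1" and X: "(X has_vector_derivative hill_matrix g t ** X t) (at t)"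
    using assms by (auto simp: fundamental_matrix_def)
  show "X 0 $ 1 $ 1 = 1" "X 0 $ 1 $ 2 = 0" "X 0 $ 2 $ 1 = 0" "X 0 $ 2 $ 2 = 1"
    by (simp_all add: X0 mat_def)
  have entry: "((\<lambda>t. X t $ i $ j) has_real_derivative (hill_matrix g t ** X t) $ i $ j) (at t)" for i
    unfolding has_real_derivative_iff_has_vector_derivative
    by (intro bounded_linear.has_vector_derivative[OF bounded_linear_vec_nth]
        bounded_linear.has_vector_derivative[OF bounded_linear_vec_nth X])
  show "((\<lambda>t. X t $ 1 $ j) has_real_derivative X t $ 2 $ j) (at t)"
    and "((\<lambda>t. X t $ 2 $ j) has_real_derivative g t * X t $ 1 $ j) (at t)"
    using entry[of 1] entry[of 2] by (simp_all add: hill_matrix_def matrix_matrix_mult_def sum_2)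
qed

lemma fundamental_matrix_hillI:
  assumes x: "\<And>t. (x has_real_derivative y t) (at t)" "\<And>t. (y has_real_derivative g t * x t) (at t)"
    and u: "\<And>t. (u has_real_derivative v t) (at t)" "\<And>t. (v has_real_derivative g t * u t) (at t)"
    and init: "x 0 = 1" "y 0 = 0" "u 0 = 0" "v 0 = 1"
  shows "fundamental_matrix (hill_matrix g) (\<lambda>t. vector [vector [x t, u t], vector [y t, v t]])"
  unfolding fundamental_matrix_def
proof (intro conjI allI)
  show "vector [vector [x 0, u 0], vector [y 0, v 0]] = (mat 1 :: real ^ 2 ^ 2)"
    by (simp add: vec_eq_iff forall_2 mat_def init)
  fix t
  have split: "(\<lambda>t. vector [vector [x t, u t], vector [y t, v t]] :: real ^ 2 ^ 2) =
      (\<lambda>t. x t *\<^sub>R vector [vector [1, 0], vector [0, 0]] + u t *\<^sub>R vector [vector [0, 1], vector [0, 0]]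
         + y t *\<^sub>R vector [vector [0, 0], vector [1, 0]] + v t *\<^sub>R vector [vector [0, 0], vector [0, 1]])"
    by (simp add: fun_eq_iff vec_eq_iff forall_2)
  have "((\<lambda>t. x t *\<^sub>R vector [vector [1, 0], vector [0, 0]] + u t *\<^sub>R vector [vector [0, 1], vector [0, 0]]
         + y t *\<^sub>R vector [vector [0, 0], vector [1, 0]] + v t *\<^sub>R vector [vector [0, 0], vector [0, 1]]
         :: real ^ 2 ^ 2) has_vector_derivative hill_matrix g t ** vector [vector [x t, u t], vector [y t, v t]]) (at t)"
    by (rule derivative_eq_intros x u refl)+
       (simp add: vec_eq_iff forall_2 hill_matrix_def matrix_matrix_mult_def sum_2)
  then show "((\<lambda>t. vector [vector [x t, u t], vector [y t, v t]] :: real ^ 2 ^ 2) has_vector_derivative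
      hill_matrix g t ** vector [vector [x t, u t], vector [y t, v t]]) (at t)"
    unfolding split .
qed

lemma hill_determinant:
  assumes "fundamental_matrix (hill_matrix g) X"
  shows "X t $ 1 $ 1 * X t $ 2 $ 2 - X t $ 2 $ 1 * X t $ 1 $ 2 = 1"
  using wronskian_constant[OF fundamental_matrix_hillD(5,6)[OF assms, of 1] fundamental_matrix_hillD(5,6)[OF assms, of 2],
      of t 0] fundamental_matrix_hillD(1-4)[OF assms] by simp

text \<open>
  The Wronskians of the columns of \<open>X\<close> with those of \<open>Y\<close> are constant; their initial values determine
  \<open>Y t\<close> from \<open>X t\<close> by Cramer's rule.
\<close>

lemma fundamental_matrix_hill_unique:
  assumes X: "fundamental_matrix (hill_matrix g) X" and Y: "fundamental_matrix (hill_matrix g) Y"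
  shows "X t = Y t"
proof -
  note X' = fundamental_matrix_hillD[OF X] and Y' = fundamental_matrix_hillD[OF Y]
  have det: "X t $ 1 $ 1 * X t $ 2 $ 2 - X t $ 2 $ 1 * X t $ 1 $ 2 = 1"
    by (rule hill_determinant[OF X])
  have W: "X t $ 1 $ i * Y t $ 2 $ j - X t $ 2 $ i * Y t $ 1 $ j
      = X 0 $ 1 $ i * Y 0 $ 2 $ j - X 0 $ 2 $ i * Y 0 $ 1 $ j" for i j
    by (rule wronskian_constant[OF X'(5,6) Y'(5,6)])
  have w11: "X t $ 1 $ 1 * Y t $ 2 $ 1 - X t $ 2 $ 1 * Y t $ 1 $ 1 = 0"
   and w12: "X t $ 1 $ 1 * Y t $ 2 $ 2 - X t $ 2 $ 1 * Y t $ 1 $ 2 = 1"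
   and w21: "X t $ 1 $ 2 * Y t $ 2 $ 1 - X t $ 2 $ 2 * Y t $ 1 $ 1 = -1"
   and w22: "X t $ 1 $ 2 * Y t $ 2 $ 2 - X t $ 2 $ 2 * Y t $ 1 $ 2 = 0"
    using W[of 1 1] W[of 1 2] W[of 2 1] W[of 2 2] X'(1-4) Y'(1-4) by simp_all
  have "Y t $ 1 $ 1 = X t $ 1 $ 1" "Y t $ 2 $ 1 = X t $ 2 $ 1" "Y t $ 1 $ 2 = X t $ 1 $ 2" "Y t $ 2 $ 2 = X t $ 2 $ 2"
    using cramer_2[OF det w11 w21] cramer_2[OF det w12 w22] by simp_all
  then show ?thesis by (simp add: vec_eq_iff forall_2)
qed

text \<open>
  By symmetry, \<open>t \<mapsto> x(2T - t)\<close> solves the same equation.  Its Wronskian with the other column is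
  constant: at time 0 it is a diagonal entry of \<open>X (2T)\<close>, at the midpoint \<open>T\<close> it is the permanent of \<open>X T\<close>.
\<close>

lemma hill_trace_symmetric:
  assumes X: "fundamental_matrix (hill_matrix g) X" and sym: "\<And>t. g (2 * T - t) = g t"
  shows "X (2 * T) $ 1 $ 1 + X (2 * T) $ 2 $ 2 =
      2 * (X T $ 1 $ 1 * X T $ 2 $ 2 + X T $ 1 $ 2 * X T $ 2 $ 1)"
proof -
  note D = fundamental_matrix_hillD[OF X]
  have reflect: "((\<lambda>t. 2 * T - t) has_real_derivative - 1) (at t)" for t
    by (auto intro!: derivative_eq_intros)
  have R1: "((\<lambda>t. X (2 * T - t) $ 1 $ j) has_real_derivative - X (2 * T - t) $ 2 $ j) (at t)" for j t
    using DERIV_chain2[OF D(5) reflect, of j t] by simp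
  have R2: "((\<lambda>t. - X (2 * T - t) $ 2 $ j) has_real_derivative g t * X (2 * T - t) $ 1 $ j) (at t)" for j t
    using DERIV_minus[OF DERIV_chain2[OF D(6) reflect, of j t]] sym[of t] by simp
  have W: "X (2 * T) $ 1 $ i * X 0 $ 2 $ j + X (2 * T) $ 2 $ i * X 0 $ 1 $ j
      = X T $ 1 $ i * X T $ 2 $ j + X T $ 2 $ i * X T $ 1 $ j" for i j
  proof -
    have "X (2 * T - 0) $ 1 $ i * X 0 $ 2 $ j - (- X (2 * T - 0) $ 2 $ i) * X 0 $ 1 $ j
        = X (2 * T - T) $ 1 $ i * X T $ 2 $ j - (- X (2 * T - T) $ 2 $ i) * X T $ 1 $ j"
      by (rule wronskian_constant[OF R1 R2 D(5,6)])
    then show ?thesis by simp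
  qed
  show ?thesis
    using W[of 1 2] W[of 2 1] D(1-4) by (simp add: algebra_simps)
qed

text \<open>
  The Cayley-Hamilton combinations of the two eigenvector equations annihilate both components of the
  eigenvector.
\<close>

lemma complex_eigenvalue_characteristic:
  fixes M :: "real ^ 2 ^ 2"
  assumes "complex_eigenvalue M \<mu>" and det: "det M = 1"
  shows "\<mu>\<^sup>2 - complex_of_real (trace M) * \<mu> + 1 = 0"
proof -
  obtain v :: "complex ^ 2" where v: "v \<noteq> 0" "map_matrix complex_of_real M *v v = \<mu> *s v"
    using assms(1) by (auto simp: complex_eigenvalue_def)
  define a b c d where "a = complex_of_real (M $ 1 $ 1)" and "b = complex_of_real (M $ 1 $ 2)"
    and "c = complex_of_real (M $ 2 $ 1)" and "d = complex_of_real (M $ 2 $ 2)"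
  note defs = a_def b_def c_def d_def
  have e1: "a * v $ 1 + b * v $ 2 = \<mu> * v $ 1" and e2: "c * v $ 1 + d * v $ 2 = \<mu> * v $ 2"
    using v(2) by (auto simp: defs vec_eq_iff forall_2 matrix_vector_mult_def sum_2)
  have dt: "a * d - b * c = 1"
    using det unfolding defs det_2 by (metis of_real_1 of_real_diff of_real_mult)
  have tr: "complex_of_real (trace M) = a + d"
    by (simp add: defs trace_def sum_2)
  have "(\<mu>\<^sup>2 - (a + d) * \<mu> + (a * d - b * c)) * v $ 1
      = (d - \<mu>) * ((a * v $ 1 + b * v $ 2) - \<mu> * v $ 1) - b * ((c * v $ 1 + d * v $ 2) - \<mu> * v $ 2)"
    "(\<mu>\<^sup>2 - (a + d) * \<mu> + (a * d - b * c)) * v $ 2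
      = (a - \<mu>) * ((c * v $ 1 + d * v $ 2) - \<mu> * v $ 2) - c * ((a * v $ 1 + b * v $ 2) - \<mu> * v $ 1)"
    by (simp_all add: algebra_simps power2_eq_square)
  then have "(\<mu>\<^sup>2 - (a + d) * \<mu> + 1) * v $ 1 = 0" "(\<mu>\<^sup>2 - (a + d) * \<mu> + 1) * v $ 2 = 0"
    using e1 e2 dt by simp_all
  moreover have "v $ 1 \<noteq> 0 \<or> v $ 2 \<noteq> 0"
    using v(1) by (auto simp: vec_eq_iff forall_2)
  ultimately show ?thesis by (auto simp: tr)
qed

lemma elliptic_multipliers:
  fixes M :: "real ^ 2 ^ 2"
  assumes "complex_eigenvalue M \<mu>" and "det M = 1" and "\<bar>trace M\<bar> < 2"
  shows "cmod \<mu> = 1 \<and> \<mu> \<notin> \<real>"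
proof -
  define \<tau> p q where "\<tau> = trace M" and "p = Re \<mu>" and "q = Im \<mu>"
  have char: "\<mu>\<^sup>2 - complex_of_real \<tau> * \<mu> + 1 = 0"
    using complex_eigenvalue_characteristic[OF assms(1,2)] by (simp add: \<tau>_def)
  have re: "p\<^sup>2 - q\<^sup>2 - \<tau> * p + 1 = 0" and im: "q * (2 * p - \<tau>) = 0"
    using arg_cong[OF char, of Re] arg_cong[OF char, of Im]
    by (simp_all add: p_def q_def power2_eq_square algebra_simps)
  have "\<tau>\<^sup>2 < 2\<^sup>2"
    using assms(3) power_strict_mono[of "\<bar>\<tau>\<bar>" 2 2] by (simp add: \<tau>_def)
  then have disc: "\<tau>\<^sup>2 < 4" by simp
  have "q \<noteq> 0"
  proof
    assume "q = 0"
    then have "(2 * p - \<tau>)\<^sup>2 = \<tau>\<^sup>2 - 4" using re by (simp add: power2_eq_square algebra_simps)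
    then show False using disc zero_le_power2[of "2 * p - \<tau>"] by linarith
  qed
  then have "\<tau> = 2 * p" using im by simp
  then have "p\<^sup>2 + q\<^sup>2 = 1" using re by (simp add: power2_eq_square)
  then have "cmod \<mu> = 1" by (simp add: cmod_def p_def q_def)
  moreover have "\<mu> \<notin> \<real>" using \<open>q \<noteq> 0\<close> by (simp add: complex_is_Real_iff q_def)
  ultimately show ?thesis ..
qed

text \<open>
  With determinant 1 and trace \<open>2\<sigma> = \<plusminus>2\<close>, the number \<open>\<sigma>\<close> is a double root of the characteristic
  polynomial.
\<close>

lemma real_multiplier_of_parabolic:
  fixes M :: "real ^ 2 ^ 2"
  assumes det: "det M = 1" and tr: "trace M = 2 * \<sigma>" and \<sigma>: "\<sigma>\<^sup>2 = 1"
  shows "complex_eigenvalue M (complex_of_real \<sigma>)"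
proof -
  define a b c d where "a = M $ 1 $ 1" and "b = M $ 1 $ 2" and "c = M $ 2 $ 1" and "d = M $ 2 $ 2"
  note defs = a_def b_def c_def d_def
  have d: "d = 2 * \<sigma> - a" using tr by (simp add: defs trace_def sum_2)
  have bc: "b * c = - (\<sigma> - a)\<^sup>2"
    using det \<sigma> unfolding det_2 defs[symmetric] d by (simp add: algebra_simps power2_eq_square)
  \<comment> \<open>A kernel vector of \<open>M - \<sigma>\<close> read off from its first row; if that row vanishes, then \<open>d = \<sigma>\<close> and the
     second unit vector works.\<close>
  define v :: "real ^ 2" where "v = (if b = 0 \<and> a = \<sigma> then vector [0, 1] else vector [b, \<sigma> - a])"
  have v: "v \<noteq> 0" "a * v $ 1 + b * v $ 2 = \<sigma> * v $ 1" "c * v $ 1 + d * v $ 2 = \<sigma> * v $ 2"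
    using bc by (auto simp: v_def vec_eq_iff forall_2 d power2_eq_square algebra_simps)
  define w :: "complex ^ 2" where "w = vector [complex_of_real (v $ 1), complex_of_real (v $ 2)]"
  have "w \<noteq> 0" using v(1) by (auto simp: w_def vec_eq_iff forall_2)
  moreover have "map_matrix complex_of_real M *v w = complex_of_real \<sigma> *s w"
    using arg_cong[OF v(2), of complex_of_real] arg_cong[OF v(3), of complex_of_real]
    by (simp add: w_def vec_eq_iff forall_2 matrix_vector_mult_def sum_2 defs)
  ultimately show ?thesis by (auto simp: complex_eigenvalue_def)
qed

lemma hill_strongly_stableI:
  assumes X: "fundamental_matrix (hill_matrix g) X" and "\<bar>trace (X T)\<bar> < 2"
  shows "strongly_stable (hill_matrix g) T"
  unfolding strongly_stable_def monodromy_matrix_def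
  using assms elliptic_multipliers[of "X T"] hill_determinant[OF X, of T]
  by (auto simp: det_2 mult.commute)

lemma hill_not_strongly_stableI:
  assumes X: "fundamental_matrix (hill_matrix g) X" and tr: "\<bar>trace (X T)\<bar> = 2"
  shows "\<not> strongly_stable (hill_matrix g) T"
proof
  assume "strongly_stable (hill_matrix g) T"
  then obtain Y where Y: "fundamental_matrix (hill_matrix g) Y"
    and ev: "\<And>\<mu>. complex_eigenvalue (Y T) \<mu> \<Longrightarrow> \<mu> \<notin> \<real>"
    by (auto simp: strongly_stable_def monodromy_matrix_def)
  have "Y T = X T" by (rule fundamental_matrix_hill_unique[OF Y X])
  have "complex_eigenvalue (X T) (complex_of_real (trace (X T) / 2))"
  proof (rule real_multiplier_of_parabolic)
    show "det (X T) = 1" using hill_determinant[OF X, of T] by (simp add: det_2 mult.commute)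
    have "(trace (X T))\<^sup>2 = 2\<^sup>2" using tr by (metis power2_abs)
    then show "(trace (X T) / 2)\<^sup>2 = 1" by (simp add: power_divide)
  qed simp
  then show False using ev \<open>Y T = X T\<close> Reals_of_real by metis
qed

section \<open>The scaled Pruefer angle\<close>

text \<open>
  The derivative of the angle \<open>\<theta>\<close> in \<open>\<omega>x = R cos \<theta>\<close>, \<open>y = -R sin \<theta>\<close> along \<open>x' = y\<close>, \<open>y' = g x\<close>.  The
  scaling by \<open>\<omega>\<close> makes the rotation uniform, of speed \<open>\<omega>\<close>, for the harmonic oscillator
  \<open>g = -\<omega>\<^sup>2\<close>.
\<close>

definition pruefer_speed :: "real \<Rightarrow> real \<Rightarrow> real \<Rightarrow> real \<Rightarrow> real" where
  "pruefer_speed \<omega> g x y = \<omega> * (y\<^sup>2 - g * x\<^sup>2) / (\<omega>\<^sup>2 * x\<^sup>2 + y\<^sup>2)"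

text \<open>
  With \<open>\<omega>x = R cos \<theta>\<close> and \<open>y = -R sin \<theta>\<close> the claim is \<open>R cos \<theta> sin \<theta> = R sin \<theta> cos \<theta>\<close>.  To avoid
  constructing \<open>R\<close>, let \<open>S\<close> be the left-hand side and \<open>Q = \<omega>\<^sup>2x\<^sup>2 + y\<^sup>2\<close>, which would be \<open>R\<^sup>2\<close>.  The speed is
  chosen such that \<open>S\<close> and \<open>R\<close> have the same logarithmic derivative, so \<open>S\<^sup>2/Q\<close> is constant, and it
  starts at 0.
\<close>

lemma pruefer_angle_direction:
  assumes x: "\<And>t. (x has_real_derivative y t) (at t)" and y: "\<And>t. (y has_real_derivative g t * x t) (at t)"
    and \<theta>: "\<And>t. (\<theta> has_real_derivative pruefer_speed \<omega> (g t) (x t) (y t)) (at t)"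
    and init: "y 0 = 0" "\<theta> 0 = 0"
    and nz: "\<And>t. x t \<noteq> 0 \<or> y t \<noteq> 0" and \<omega>: "\<omega> \<noteq> 0"
  shows "\<omega> * x t * sin (\<theta> t) + y t * cos (\<theta> t) = 0"
proof -
  define Q where "Q t = \<omega>\<^sup>2 * (x t)\<^sup>2 + (y t)\<^sup>2" for t
  define S where "S t = \<omega> * x t * sin (\<theta> t) + y t * cos (\<theta> t)" for t
  have Q: "Q t > 0" for t
    using nz[of t] \<omega> by (auto simp: Q_def sum_power2_gt_zero_iff simp flip: power_mult_distrib)
  define S' where "S' t = \<omega> * y t * sin (\<theta> t) + g t * x t * cos (\<theta> t)
      + pruefer_speed \<omega> (g t) (x t) (y t) * (\<omega> * x t * cos (\<theta> t) - y t * sin (\<theta> t))" for t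
  have dS: "(S has_real_derivative S' t) (at t)" for t
    unfolding S_def S'_def
    by (rule derivative_eq_intros x y \<theta> refl)+ (simp add: algebra_simps)
  have dQ: "(Q has_real_derivative 2 * (\<omega>\<^sup>2 + g t) * x t * y t) (at t)" for t
    unfolding Q_def by (rule derivative_eq_intros x y refl)+ (simp add: algebra_simps power2_eq_square)
  have growth: "S' t * Q t = (\<omega>\<^sup>2 + g t) * x t * y t * S t" for t
  proof -
    have "pruefer_speed \<omega> (g t) (x t) (y t) * Q t = \<omega> * ((y t)\<^sup>2 - g t * (x t)\<^sup>2)"
      using Q[of t] by (simp add: pruefer_speed_def Q_def)
    moreover have "S' t * Q t = (\<omega> * y t * sin (\<theta> t) + g t * x t * cos (\<theta> t)) * Q t
        + (pruefer_speed \<omega> (g t) (x t) (y t) * Q t) * (\<omega> * x t * cos (\<theta> t) - y t * sin (\<theta> t))"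
      by (simp add: S'_def algebra_simps)
    ultimately have "S' t * Q t = (\<omega> * y t * sin (\<theta> t) + g t * x t * cos (\<theta> t)) * Q t
        + (\<omega> * ((y t)\<^sup>2 - g t * (x t)\<^sup>2)) * (\<omega> * x t * cos (\<theta> t) - y t * sin (\<theta> t))"
      by simp
    then show ?thesis by (simp add: S_def Q_def algebra_simps power2_eq_square)
  qed
  have "(S t)\<^sup>2 / Q t = (S 0)\<^sup>2 / Q 0"
  proof (rule DERIV_isconst_all[rule_format, where f = "\<lambda>t. (S t)\<^sup>2 / Q t"])
    fix t
    have "((\<lambda>t. (S t)\<^sup>2 / Q t) has_real_derivative
        ((2 * S t * S' t) * Q t - (S t)\<^sup>2 * (2 * (\<omega>\<^sup>2 + g t) * x t * y t)) / (Q t * Q t)) (at t)"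
      by (rule derivative_eq_intros dS dQ refl)+ (use Q[of t] in auto)
    moreover have "(2 * S t * S' t) * Q t - (S t)\<^sup>2 * (2 * (\<omega>\<^sup>2 + g t) * x t * y t) = 0"
    proof -
      have "(2 * S t * S' t) * Q t = 2 * S t * (S' t * Q t)" by simp
      then show ?thesis unfolding growth by (simp add: power2_eq_square algebra_simps)
    qed
    ultimately show "((\<lambda>t. (S t)\<^sup>2 / Q t) has_real_derivative 0) (at t)" by simp
  qed
  then show ?thesis
    using Q[of t] init by (simp add: S_def)
qed

text \<open>
  Since \<open>\<omega>\<^sup>2x\<^sup>2 \<le> \<omega>\<^sup>2x\<^sup>2 + y\<^sup>2\<close>, a repulsive force of strength at most \<open>G\<close> turns the angle back at speed at
  most \<open>G/\<omega>\<close>, whereas an attraction stronger than \<open>\<omega>\<^sup>2\<close> turns it forward at speed at least \<open>\<omega>\<close>.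
\<close>

lemma pruefer_angle_lower_bound:
  assumes \<theta>: "\<And>t. (\<theta> has_real_derivative pruefer_speed \<omega> (g t) (x t) (y t)) (at t)" and "\<theta> 0 = 0"
    and nz: "\<And>t. x t \<noteq> 0 \<or> y t \<noteq> 0" and \<omega>: "0 < \<omega>"
    and G: "0 \<le> G" "\<And>t. t \<in> {0..T} \<Longrightarrow> g t \<le> G"
    and \<kappa>: "0 \<le> \<kappa>" "\<kappa> \<le> T" "\<And>t. t \<in> {T - \<kappa>..T} \<Longrightarrow> g t \<le> - \<omega>\<^sup>2"
  shows "\<kappa> * \<omega> - G * T / \<omega> \<le> \<theta> T"
proof -
  have Q: "0 < \<omega>\<^sup>2 * (x t)\<^sup>2 + (y t)\<^sup>2" for t
    using nz[of t] \<omega> by (auto simp: sum_power2_gt_zero_iff simp flip: power_mult_distrib)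
  have slow: "- (G / \<omega>) \<le> pruefer_speed \<omega> (g t) (x t) (y t)" if "t \<in> {0..T}" for t
  proof -
    have "g t * (x t)\<^sup>2 \<le> G * (x t)\<^sup>2" by (intro mult_right_mono G that) simp
    then have "\<omega>\<^sup>2 * (g t * (x t)\<^sup>2) \<le> \<omega>\<^sup>2 * (G * (x t)\<^sup>2)"
      by (rule mult_left_mono) simp
    moreover have "0 \<le> G * (y t)\<^sup>2" "0 \<le> \<omega>\<^sup>2 * (y t)\<^sup>2" using G by simp_all
    moreover have "\<omega>\<^sup>2 * ((y t)\<^sup>2 - g t * (x t)\<^sup>2) + G * (\<omega>\<^sup>2 * (x t)\<^sup>2 + (y t)\<^sup>2)
        = \<omega>\<^sup>2 * (y t)\<^sup>2 + G * (y t)\<^sup>2 + (\<omega>\<^sup>2 * (G * (x t)\<^sup>2) - \<omega>\<^sup>2 * (g t * (x t)\<^sup>2))"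
      by (simp add: algebra_simps)
    ultimately have "- G * (\<omega>\<^sup>2 * (x t)\<^sup>2 + (y t)\<^sup>2) \<le> \<omega>\<^sup>2 * ((y t)\<^sup>2 - g t * (x t)\<^sup>2)"
      by linarith
    then show ?thesis using Q[of t] \<omega>
      by (simp add: pruefer_speed_def field_simps power2_eq_square)
  qed
  have fast: "\<omega> \<le> pruefer_speed \<omega> (g t) (x t) (y t)" if "t \<in> {T - \<kappa>..T}" for t
  proof -
    have "g t * (x t)\<^sup>2 \<le> - \<omega>\<^sup>2 * (x t)\<^sup>2" by (intro mult_right_mono \<kappa> that) simp
    then have "\<omega> * (\<omega>\<^sup>2 * (x t)\<^sup>2 + (y t)\<^sup>2) \<le> \<omega> * ((y t)\<^sup>2 - g t * (x t)\<^sup>2)"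
      using \<omega> by (intro mult_left_mono) auto
    then show ?thesis using Q[of t] unfolding pruefer_speed_def by (subst le_divide_eq) auto
  qed
  have "\<theta> 0 + G / \<omega> * 0 \<le> \<theta> (T - \<kappa>) + G / \<omega> * (T - \<kappa>)"
  proof (rule DERIV_nonneg_imp_nondecreasing[where f = "\<lambda>t. \<theta> t + G / \<omega> * t"])
    fix t assume "0 \<le> t" "t \<le> T - \<kappa>"
    then have t: "t \<in> {0..T}" using \<kappa> by auto
    show "\<exists>D. ((\<lambda>t. \<theta> t + G / \<omega> * t) has_real_derivative D) (at t) \<and> 0 \<le> D"
      using slow[OF t] \<omega>
      by (intro exI[of _ "pruefer_speed \<omega> (g t) (x t) (y t) + G / \<omega>"])
         (auto intro!: derivative_eq_intros \<theta>)
  qed (use \<kappa> in auto)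
  moreover have "\<theta> (T - \<kappa>) - \<omega> * (T - \<kappa>) \<le> \<theta> T - \<omega> * T"
  proof (rule DERIV_nonneg_imp_nondecreasing[where f = "\<lambda>t. \<theta> t - \<omega> * t"])
    fix t assume "T - \<kappa> \<le> t" "t \<le> T"
    then have t: "t \<in> {T - \<kappa>..T}" by auto
    show "\<exists>D. ((\<lambda>t. \<theta> t - \<omega> * t) has_real_derivative D) (at t) \<and> 0 \<le> D"
      using fast[OF t]
      by (intro exI[of _ "pruefer_speed \<omega> (g t) (x t) (y t) - \<omega>"])
         (auto intro!: derivative_eq_intros \<theta>)
  qed (use \<kappa> in auto)
  moreover have "G / \<omega> * (T - \<kappa>) \<le> G / \<omega> * T"
    using G \<omega> \<kappa> by (intro mult_left_mono) auto
  ultimately show ?thesis using \<open>\<theta> 0 = 0\<close> by (simp add: algebra_simps)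
qed

section \<open>Kepler's equation\<close>

lemma abs_sin_diff_le_abs_diff: "\<bar>sin x - sin y\<bar> \<le> \<bar>x - y\<bar>" for x y :: real
proof -
  have "norm (sin x - sin y) \<le> 1 * norm (x - y)"
    by (rule field_differentiable_bound[of UNIV sin cos]) (auto intro: DERIV_sin)
  then show ?thesis by simp
qed

lemma abs_cos_diff_le_abs_diff: "\<bar>cos x - cos y\<bar> \<le> \<bar>x - y\<bar>" for x y :: real
  using abs_sin_diff_le_abs_diff[of "pi/2 - x" "pi/2 - y"] by (simp add: cos_sin_eq abs_minus_commute)

context
  fixes \<epsilon> :: real
  assumes ecc: "0 \<le> \<epsilon>" "\<epsilon> < 1"
begin

lemma kepler_equation: "eccentric_anomaly \<epsilon> t - \<epsilon> * sin (eccentric_anomaly \<epsilon> t) = t"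
  unfolding eccentric_anomaly_def by (rule theI'[OF kepler_equation_ex1[OF ecc]])

lemma eccentric_anomaly_eqI: "u - \<epsilon> * sin u = t \<Longrightarrow> eccentric_anomaly \<epsilon> t = u"
  using kepler_equation_ex1[OF ecc, of t] kepler_equation[of t] by blast

lemma eccentric_anomaly_reflect: "eccentric_anomaly \<epsilon> (2 * pi - t) = 2 * pi - eccentric_anomaly \<epsilon> t"
proof (rule eccentric_anomaly_eqI)
  show "2 * pi - eccentric_anomaly \<epsilon> t - \<epsilon> * sin (2 * pi - eccentric_anomaly \<epsilon> t) = 2 * pi - t"
    using kepler_equation[of t] by (simp add: sin_diff)
qed

text \<open>
  Kepler's equation is a perturbation of the identity by a map with Lipschitz constant \<open>\<epsilon> < 1\<close>.
\<close>

lemma eccentric_anomaly_lipschitz: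
  "\<bar>eccentric_anomaly \<epsilon> t - eccentric_anomaly \<epsilon> s\<bar> \<le> \<bar>t - s\<bar> / (1 - \<epsilon>)"
proof -
  let ?u = "eccentric_anomaly \<epsilon> t" and ?v = "eccentric_anomaly \<epsilon> s"
  have "?u - ?v = (t - s) + \<epsilon> * (sin ?u - sin ?v)"
    using kepler_equation[of t] kepler_equation[of s] by (simp add: algebra_simps)
  then have "\<bar>?u - ?v\<bar> \<le> \<bar>t - s\<bar> + \<epsilon> * \<bar>sin ?u - sin ?v\<bar>"
    using ecc abs_triangle_ineq[of "t - s" "\<epsilon> * (sin ?u - sin ?v)"] by (simp add: abs_mult)
  also have "\<dots> \<le> \<bar>t - s\<bar> + \<epsilon> * \<bar>?u - ?v\<bar>"
    using ecc abs_sin_diff_le_abs_diff by (intro add_left_mono mult_left_mono) auto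
  finally show ?thesis using ecc by (simp add: field_simps)
qed

lemma rho_reflect: "rho \<epsilon> (2 * pi - t) = rho \<epsilon> t"
  by (simp add: rho_def eccentric_anomaly_reflect cos_diff)

lemma rho_pi: "rho \<epsilon> pi = 1 + \<epsilon>"
  by (simp add: rho_def eccentric_anomaly_eqI[of pi])

lemma rho_bounds: "0 < rho \<epsilon> t" "rho \<epsilon> t \<le> 1 + \<epsilon>"
proof -
  have "\<bar>\<epsilon> * cos (eccentric_anomaly \<epsilon> t)\<bar> \<le> \<epsilon> * 1"
    unfolding abs_mult using ecc by (intro mult_mono) auto
  then show "0 < rho \<epsilon> t" "rho \<epsilon> t \<le> 1 + \<epsilon>" using ecc by (auto simp: rho_def)
qed

lemma rho_lipschitz: "\<bar>rho \<epsilon> t - rho \<epsilon> s\<bar> \<le> \<bar>t - s\<bar> / (1 - \<epsilon>)"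
proof -
  have "\<bar>rho \<epsilon> t - rho \<epsilon> s\<bar> = \<epsilon> * \<bar>cos (eccentric_anomaly \<epsilon> t) - cos (eccentric_anomaly \<epsilon> s)\<bar>"
    using ecc by (simp add: rho_def abs_mult abs_minus_commute flip: right_diff_distrib)
  also have "\<dots> \<le> 1 * \<bar>eccentric_anomaly \<epsilon> t - eccentric_anomaly \<epsilon> s\<bar>"
    using ecc abs_cos_diff_le_abs_diff by (intro mult_mono) auto
  also have "\<dots> \<le> \<bar>t - s\<bar> / (1 - \<epsilon>)"
    using eccentric_anomaly_lipschitz by simp
  finally show ?thesis .
qed

lemma continuous_on_rho: "continuous_on UNIV (rho \<epsilon>)"
proof (rule lipschitz_on_continuous_on)
  show "(1 / (1 - \<epsilon>))-lipschitz_on UNIV (rho \<epsilon>)"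
    using rho_lipschitz ecc by (auto simp: lipschitz_on_def dist_real_def)
qed

end

section \<open>The linearized force near the collision\<close>

text \<open>
  The contribution of a single primary to the linearized coefficient.  The polar radius of the
  primary is \<open>m\<close>, and \<open>c\<close> is its \<open>y\<close>-coordinate measured from the common focus \<open>(0, 1, 0)\<close>.  Negative values attract the particle to the equilibrium.
\<close>

definition attraction :: "real \<Rightarrow> real \<Rightarrow> real" where
  "attraction m c = (1 + c) / (m\<^sup>2 + 4 * (1 + c)) powr (3/2)"

definition hill_coefficient :: "real \<Rightarrow> real \<Rightarrow> real \<Rightarrow> real" where
  "hill_coefficient \<epsilon> r t =
     attraction (r * rho \<epsilon> t) (r * rho \<epsilon> t * cos t) + attraction (r * rho \<epsilon> t) (- (r * rho \<epsilon> t * cos t))"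

lemma square_powr_three_halves:
  fixes d :: real
  assumes "0 \<le> d" shows "(d\<^sup>2) powr (3/2) = d ^ 3"
proof (cases "d = 0")
  case False
  then have d: "0 < d" using assms by simp
  have "(d\<^sup>2) powr (3/2) = (d powr 2) powr (3/2)" using d by simp
  also have "\<dots> = d powr 3" unfolding powr_powr by simp
  also have "\<dots> = d ^ 3" using d by simp
  finally show ?thesis .
qed simp

text \<open>
  For a primary at distance \<open>m\<close> from the focus \<open>(0, 1, 0)\<close> and with \<open>y\<close>-coordinate \<open>c\<close> relative to it,
  \<open>m\<^sup>2 + 4(1 + c)\<close> is the squared distance from the equilibrium \<open>(0, -1, 0)\<close>.  The bounds are the triangle
  inequality, the focus being at distance 2, and the comparison with the difference of the \<open>y\<close>-coordinates.
\<close>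

lemma squared_distance_bounds:
  fixes m c :: real
  assumes "\<bar>c\<bar> \<le> m" "m < 2"
  shows "(2 - m)\<^sup>2 \<le> m\<^sup>2 + 4 * (1 + c)" "(2 + c)\<^sup>2 \<le> m\<^sup>2 + 4 * (1 + c)" "0 < m\<^sup>2 + 4 * (1 + c)"
proof -
  have "0 \<le> m + c" "c\<^sup>2 \<le> m\<^sup>2" using assms by (auto simp: abs_le_square_iff[symmetric])
  then show le: "(2 - m)\<^sup>2 \<le> m\<^sup>2 + 4 * (1 + c)" "(2 + c)\<^sup>2 \<le> m\<^sup>2 + 4 * (1 + c)"
    by (simp_all add: power2_eq_square algebra_simps)
  have "0 < (2 - m)\<^sup>2" using assms by simp
  then show "0 < m\<^sup>2 + 4 * (1 + c)" using le(1) by linarith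
qed

text \<open>
  A primary pushes the particle away from the equilibrium only if it lies in the half-space \<open>y > 0\<close>
  (that is, \<open>1 + c > 0\<close>), and then its distance from the equilibrium exceeds 1.  So the repulsive part
  of the coefficient stays bounded, uniformly up to the collision.
\<close>

lemma attraction_le_1:
  assumes "\<bar>c\<bar> \<le> m" "m < 2"
  shows "attraction m c \<le> 1"
proof (cases "0 < 1 + c")
  case True
  have "1 + c \<le> (2 + c) ^ 3" using True self_le_power[of "2 + c" 3] by simp
  also have "\<dots> = ((2 + c)\<^sup>2) powr (3/2)" using True by (simp add: square_powr_three_halves)
  also have "\<dots> \<le> (m\<^sup>2 + 4 * (1 + c)) powr (3/2)"
    using squared_distance_bounds[OF assms] by (intro powr_mono2) auto
  finally show ?thesis using squared_distance_bounds(3)[OF assms] by (simp add: attraction_def)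
next
  case False
  then have "attraction m c \<le> 0" by (simp add: attraction_def divide_nonpos_nonneg)
  then show ?thesis by simp
qed

lemma abs_attraction_le:
  assumes "\<bar>c\<bar> \<le> m" "m \<le> 2 - d" "0 < d"
  shows "\<bar>attraction m c\<bar> \<le> 3 / d ^ 3"
proof -
  have m: "m < 2" using assms by simp
  have "d\<^sup>2 \<le> (2 - m)\<^sup>2" using assms by (intro power_mono) auto
  then have "d\<^sup>2 \<le> m\<^sup>2 + 4 * (1 + c)" using squared_distance_bounds(1)[OF assms(1) m] by linarith
  then have "(d\<^sup>2) powr (3/2) \<le> (m\<^sup>2 + 4 * (1 + c)) powr (3/2)"
    by (intro powr_mono2) auto
  then have "d ^ 3 \<le> (m\<^sup>2 + 4 * (1 + c)) powr (3/2)"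
    using assms by (simp add: square_powr_three_halves)
  moreover have "\<bar>1 + c\<bar> \<le> 3" using assms by auto
  ultimately show ?thesis
    unfolding attraction_def abs_divide using assms by (intro frac_le) auto
qed

text \<open>
  A primary within distance \<open>w \<le> 1/2\<close> of the equilibrium has \<open>1 + c \<le> -1/2\<close>, so it attracts with
  strength at least \<open>1/(2w\<^sup>3)\<close>.
\<close>

lemma attraction_le_near_collision:
  assumes "\<bar>c\<bar> \<le> m" "m < 2" "m\<^sup>2 + 4 * (1 + c) \<le> w\<^sup>2" "0 < w" "w \<le> 1/2"
  shows "attraction m c \<le> - 1 / (2 * w ^ 3)"
proof -
  note P = squared_distance_bounds[OF assms(1,2)]
  have "(2 + c)\<^sup>2 \<le> w\<^sup>2" using P(2) assms(3) by linarith
  then have "\<bar>2 + c\<bar> \<le> \<bar>w\<bar>" by (simp only: abs_le_square_iff)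
  then have c: "1/2 \<le> - (1 + c)" using assms by auto
  have "(m\<^sup>2 + 4 * (1 + c)) powr (3/2) \<le> (w\<^sup>2) powr (3/2)"
    using P(3) assms by (intro powr_mono2) auto
  also have "\<dots> = w ^ 3" using assms by (simp add: square_powr_three_halves)
  finally have "(1/2) / w ^ 3 \<le> - (1 + c) / (m\<^sup>2 + 4 * (1 + c)) powr (3/2)"
    using c P(3) by (intro frac_le) auto
  moreover have "attraction m c = - (- (1 + c) / (m\<^sup>2 + 4 * (1 + c)) powr (3/2))"
    by (simp only: attraction_def minus_divide_left[symmetric] minus_minus)
  ultimately show ?thesis by simp
qed

text \<open>
  At \<open>q = \<pi>\<close> the factor \<open>sin q\<close> vanishes and the denominator is stationary, so only the derivative of
  the sine survives.
\<close>

lemma has_real_derivative_sin_quotient_at_pi: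
  fixes m c :: real
  assumes "0 < m\<^sup>2 + 4 * (1 + c)"
  shows "((\<lambda>q. (1 + c) * sin q / (m\<^sup>2 + 2 * (1 - cos q) * (1 + c)) powr (3/2))
      has_real_derivative - attraction m c) (at pi)"
proof -
  define D where "D q = m\<^sup>2 + 2 * (1 - cos q) * (1 + c)" for q
  have D_pi: "D pi = m\<^sup>2 + 4 * (1 + c)" by (simp add: D_def)
  have D: "(D has_real_derivative 2 * sin pi * (1 + c)) (at pi)"
    unfolding D_def by (auto intro!: derivative_eq_intros)
  have "((\<lambda>q. D q powr (3/2)) has_real_derivative (3/2 * D pi powr (3/2 - 1)) * (2 * sin pi * (1 + c))) (at pi)"
    using assms D_pi by (intro DERIV_chain2[OF has_real_derivative_powr D]) simp
  then have denominator: "((\<lambda>q. D q powr (3/2)) has_real_derivative 0) (at pi)" by simp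
  have numerator: "((\<lambda>q. (1 + c) * sin q) has_real_derivative - (1 + c)) (at pi)"
    by (auto intro!: derivative_eq_intros)
  define E where "E = D pi powr (3/2)"
  have "E \<noteq> 0" using assms D_pi by (simp add: E_def)
  moreover have "attraction m c = (1 + c) / E" by (simp add: attraction_def E_def D_pi)
  ultimately have "(- (1 + c) * E - (1 + c) * sin pi * 0) / (E * E) = - attraction m c"
    by (simp add: field_simps)
  from DERIV_cong[OF DERIV_divide[OF numerator denominator] this[unfolded E_def]] \<open>E \<noteq> 0\<close>
  have "((\<lambda>q. (1 + c) * sin q / D q powr (3/2)) has_real_derivative - attraction m c) (at pi)"
    by (simp add: E_def)
  then show ?thesis by (simp add: D_def)
qed

context
  fixes \<epsilon> r :: real
  assumes ecc: "0 \<le> \<epsilon>" "\<epsilon> < 1" and r: "0 < r" "r < 2 / (1 + \<epsilon>)"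
begin

lemma gap_pos: "0 < 2 - r * (1 + \<epsilon>)"
  using ecc r by (simp add: field_simps)

lemma orbit_size:
  shows "\<bar>r * rho \<epsilon> t * cos t\<bar> \<le> r * rho \<epsilon> t" "\<bar>- (r * rho \<epsilon> t * cos t)\<bar> \<le> r * rho \<epsilon> t"
    and "r * rho \<epsilon> t \<le> 2 - (2 - r * (1 + \<epsilon>))" "r * rho \<epsilon> t < 2"
proof -
  have m: "0 \<le> r * rho \<epsilon> t" using rho_bounds[OF ecc, of t] r by simp
  show "\<bar>r * rho \<epsilon> t * cos t\<bar> \<le> r * rho \<epsilon> t" "\<bar>- (r * rho \<epsilon> t * cos t)\<bar> \<le> r * rho \<epsilon> t"
    using mult_left_mono[OF abs_cos_le_one[of t] m] m
    by (simp_all add: abs_mult[of "r * rho \<epsilon> t" "cos t"])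
  show "r * rho \<epsilon> t \<le> 2 - (2 - r * (1 + \<epsilon>))" 
    using mult_left_mono[OF rho_bounds(2)[OF ecc, of t], of r] r by simp
  then show "r * rho \<epsilon> t < 2" using gap_pos by linarith
qed

lemma linearization_matrix_eq: "linearization_matrix \<epsilon> r = hill_matrix (hill_coefficient \<epsilon> r)"
proof
  fix t
  have "((\<lambda>q. sitnikov_force \<epsilon> q t r) has_real_derivative hill_coefficient \<epsilon> r t) (at pi)"
    using DERIV_diff[OF
        DERIV_minus[OF has_real_derivative_sin_quotient_at_pi[OF squared_distance_bounds(3)[OF orbit_size(1,4)]]]
        has_real_derivative_sin_quotient_at_pi[OF squared_distance_bounds(3)[OF orbit_size(2,4)]], of t t]
    by (simp add: sitnikov_force_def[abs_def] hill_coefficient_def power_mult_distrib)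
  then show "linearization_matrix \<epsilon> r t = hill_matrix (hill_coefficient \<epsilon> r) t"
    by (simp add: linearization_matrix_def hill_matrix_def DERIV_imp_deriv)
qed

lemma hill_coefficient_le_2: "hill_coefficient \<epsilon> r t \<le> 2"
  unfolding hill_coefficient_def
  using add_mono[OF attraction_le_1[OF orbit_size(1,4)] attraction_le_1[OF orbit_size(2,4)], of t t] by simp

lemma abs_hill_coefficient_le: "\<bar>hill_coefficient \<epsilon> r t\<bar> \<le> 6 / (2 - r * (1 + \<epsilon>)) ^ 3"
  unfolding hill_coefficient_def
  using order_trans[OF abs_triangle_ineq
      add_mono[OF abs_attraction_le[OF orbit_size(1,3) gap_pos] abs_attraction_le[OF orbit_size(2,3) gap_pos]], of t t]
  by (simp add: add_divide_distrib[symmetric])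

lemma hill_coefficient_reflect: "hill_coefficient \<epsilon> r (2 * pi - t) = hill_coefficient \<epsilon> r t"
  by (simp add: hill_coefficient_def rho_reflect[OF ecc] cos_diff)

text \<open>
  At \<open>t = \<pi>\<close> the first primary is at distance exactly \<open>\<delta> = 2 - r(1 + \<epsilon>)\<close> from the equilibrium, and its
  motion is Lipschitz with a constant depending only on \<open>\<epsilon>\<close>; within time \<open>\<delta>\<close> the distance is therefore
  still of order \<open>\<delta>\<close>.
\<close>

lemma distance_near_apoapsis:
  assumes t: "\<bar>t - pi\<bar> \<le> 2 - r * (1 + \<epsilon>)"
  shows "(r * rho \<epsilon> t)\<^sup>2 + 4 * (1 + r * rho \<epsilon> t * cos t)
      \<le> ((7 + 2 / (1 - \<epsilon>)) * (2 - r * (1 + \<epsilon>)))\<^sup>2"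
proof -
  define \<delta> where "\<delta> = 2 - r * (1 + \<epsilon>)"
  have \<delta>: "0 < \<delta>" using gap_pos by (simp add: \<delta>_def)
  have t: "\<bar>t - pi\<bar> \<le> \<delta>" using assms by (simp add: \<delta>_def)
  define m where "m = r * rho \<epsilon> t"
  have m: "0 \<le> m" "m < 2" using orbit_size(4) rho_bounds[OF ecc, of t] r by (auto simp: m_def)
  have r2: "r \<le> 2"
  proof -
    have "2 / (1 + \<epsilon>) \<le> 2" using ecc by (simp add: field_simps)
    then show ?thesis using r by linarith
  qed
  have "\<bar>sin t\<bar> \<le> \<delta>" using abs_sin_diff_le_abs_diff[of t pi] t by simp
  then have X: "\<bar>m * sin t\<bar> \<le> 2 * \<delta>" unfolding abs_mult using m by (intro mult_mono) auto
  have cos: "\<bar>1 + cos t\<bar> \<le> \<delta>" using abs_cos_diff_le_abs_diff[of t pi] t by (simp add: add.commute)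
  have rho: "\<bar>rho \<epsilon> pi - rho \<epsilon> t\<bar> \<le> \<delta> / (1 - \<epsilon>)"
    using rho_lipschitz[OF ecc, of pi t] t ecc divide_right_mono[of "\<bar>t - pi\<bar>" \<delta> "1 - \<epsilon>"]
    by (simp add: abs_minus_commute)
  have "2 + m * cos t = \<delta> + r * (rho \<epsilon> pi - rho \<epsilon> t) + m * (1 + cos t)"
    by (simp add: \<delta>_def m_def rho_pi[OF ecc] algebra_simps)
  moreover have "\<bar>r * (rho \<epsilon> pi - rho \<epsilon> t)\<bar> \<le> 2 * (\<delta> / (1 - \<epsilon>))"
    unfolding abs_mult using rho r r2 by (intro mult_mono) auto
  moreover have "\<bar>m * (1 + cos t)\<bar> \<le> 2 * \<delta>"
    unfolding abs_mult using cos m by (intro mult_mono) auto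
  ultimately have Y: "\<bar>2 + m * cos t\<bar> \<le> \<delta> + 2 * (\<delta> / (1 - \<epsilon>)) + 2 * \<delta>"
    using \<delta> by linarith
  have "m\<^sup>2 + 4 * (1 + m * cos t) = (m * sin t)\<^sup>2 + (2 + m * cos t)\<^sup>2"
    unfolding power_mult_distrib sin_squared_eq power2_sum by (simp add: algebra_simps)
  also have "\<dots> \<le> (\<bar>m * sin t\<bar> + \<bar>2 + m * cos t\<bar>)\<^sup>2"
    by (simp add: power2_sum)
  also have "\<dots> \<le> ((7 + 2 / (1 - \<epsilon>)) * \<delta>)\<^sup>2"
    using X Y \<delta> by (intro power_mono) (auto simp: algebra_simps)
  finally show ?thesis by (simp add: m_def \<delta>_def)
qed

text \<open>
  The second primary contributes at most 1, which costs no more than half of the attraction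
  \<open>1/(2w\<^sup>3)\<close> of the first one because \<open>w \<le> 1/2\<close>.
\<close>

lemma hill_coefficient_near_apoapsis:
  assumes t: "\<bar>t - pi\<bar> \<le> 2 - r * (1 + \<epsilon>)"
    and w: "w = (7 + 2 / (1 - \<epsilon>)) * (2 - r * (1 + \<epsilon>))" "w \<le> 1/2"
  shows "hill_coefficient \<epsilon> r t \<le> - 1 / (4 * w ^ 3)"
proof -
  have "0 < 7 + 2 / (1 - \<epsilon>)" using ecc by (simp add: add_pos_nonneg)
  then have w_pos: "0 < w" unfolding w(1) using gap_pos by simp
  have "attraction (r * rho \<epsilon> t) (r * rho \<epsilon> t * cos t) \<le> - 1 / (2 * w ^ 3)"
    using attraction_le_near_collision[OF orbit_size(1,4)] distance_near_apoapsis[OF t] w w_pos by simp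
  moreover have "attraction (r * rho \<epsilon> t) (- (r * rho \<epsilon> t * cos t)) \<le> 1"
    using attraction_le_1[OF orbit_size(2,4)] by simp
  moreover have "1 \<le> 1 / (4 * w ^ 3)"
  proof -
    have "w ^ 3 \<le> (1/2) ^ 3" using w w_pos by (intro power_mono) auto
    then show ?thesis using w_pos by (simp add: field_simps power3_eq_cube)
  qed
  ultimately show ?thesis by (simp add: hill_coefficient_def)
qed

end

lemma continuous_on_hill_coefficient:
  assumes ecc: "0 \<le> \<epsilon>" "\<epsilon> < 1"
  shows "continuous_on ({0<..<2 / (1 + \<epsilon>)} \<times> UNIV) (\<lambda>(r, t). hill_coefficient \<epsilon> r t)"
proof -
  have rho: "continuous_on A (\<lambda>p. rho \<epsilon> (snd p))" for A :: "(real \<times> real) set"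
    by (intro continuous_on_compose2[OF continuous_on_rho[OF ecc]] continuous_intros) auto
  show ?thesis
    unfolding hill_coefficient_def attraction_def case_prod_beta
    by (intro continuous_intros rho)
       (use squared_distance_bounds(3)[OF orbit_size(1,4)[OF ecc]]
            squared_distance_bounds(3)[OF orbit_size(2,4)[OF ecc]] in \<open>auto simp: less_imp_neq[THEN not_sym]\<close>)
qed

text \<open>
  The points \<open>(0, 1 - s(1 + \<epsilon>), 0)\<close> of the ellipse (at time \<open>\<pi>\<close>) and \<open>(0, -1, 0)\<close> of the circle are at
  distance \<open>2 - s(1 + \<epsilon>)\<close>.
\<close>

lemma collision_distance_tendsto_0:
  assumes ecc: "0 \<le> \<epsilon>" "\<epsilon> < 1"
  shows "((\<lambda>s. setdist (range (primary1 \<epsilon> s)) particle_circle) \<longlongrightarrow> 0) (at_left (2 / (1 + \<epsilon>)))"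
proof (rule tendsto_sandwich[where f = "\<lambda>_. 0"])
  have "((\<lambda>s. \<bar>2 - s * (1 + \<epsilon>)\<bar>) \<longlongrightarrow> \<bar>2 - 2 / (1 + \<epsilon>) * (1 + \<epsilon>)\<bar>) (at_left (2 / (1 + \<epsilon>)))"
    by (intro tendsto_intros)
  moreover have "2 / (1 + \<epsilon>) * (1 + \<epsilon>) = 2"
    using ecc by (subst times_divide_eq_left, intro nonzero_mult_div_cancel_right) simp
  ultimately show "((\<lambda>s. \<bar>2 - s * (1 + \<epsilon>)\<bar>) \<longlongrightarrow> 0) (at_left (2 / (1 + \<epsilon>)))"
    by (simp only: diff_self abs_zero)
  have "setdist (range (primary1 \<epsilon> s)) particle_circle \<le> \<bar>2 - s * (1 + \<epsilon>)\<bar>" for s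
  proof -
    have "(vector [0, cos pi, sin pi] :: real ^ 3) \<in> particle_circle"
      unfolding particle_circle_def by blast
    then have "setdist (range (primary1 \<epsilon> s)) particle_circle
        \<le> norm (primary1 \<epsilon> s pi - vector [0, cos pi, sin pi])"
      unfolding dist_norm[symmetric] by (intro setdist_le_dist) auto
    moreover have "primary1 \<epsilon> s pi - vector [0, cos pi, sin pi] = (2 - s * (1 + \<epsilon>)) *\<^sub>R axis 2 1"
      by (simp add: vec_eq_iff forall_3 primary1_def rho_pi[OF ecc] axis_def algebra_simps)
    ultimately show ?thesis by simp
  qed
  then show "\<forall>\<^sub>F s in at_left (2 / (1 + \<epsilon>)). setdist (range (primary1 \<epsilon> s)) particle_circle \<le> \<bar>2 - s * (1 + \<epsilon>)\<bar>"
    by simp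
qed (simp_all add: setdist_pos_le)

section \<open>Oscillation and alternation\<close>

lemma unbounded_angle_hits:
  fixes h :: "real \<Rightarrow> real"
  assumes h: "continuous_on {a<..<b} h" and x: "x \<in> {a<..<b}"
    and unbounded: "\<And>B x. x \<in> {a<..<b} \<Longrightarrow> \<exists>y\<in>{x<..<b}. B \<le> h y"
  shows "\<exists>r\<in>{x<..<b}. sin (h r) = 0" "\<exists>r\<in>{x<..<b}. cos (h r) = 0"
proof -
  define z where "z = (x + b) / 2"
  have z: "x < z" "z < b" "z \<in> {a<..<b}" using x by (auto simp: z_def)
  obtain k :: nat where "h z / pi \<le> real k" using real_arch_simple by blast
  then have k: "h z \<le> real k * pi" by (simp add: divide_le_eq)
  obtain y where y: "y \<in> {z<..<b}" "real k * pi + pi/2 \<le> h y" using unbounded[OF z(3)] by blast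
  have hits: "\<exists>r\<in>{x<..<b}. h r = v" if "real k * pi \<le> v" "v \<le> real k * pi + pi/2" for v
  proof -
    have "continuous_on {z..y} h"
      by (rule continuous_on_subset[OF h]) (use z y in auto)
    moreover have "h z \<le> v" "v \<le> h y" "z \<le> y" using k y that by auto
    ultimately obtain r where "z \<le> r" "r \<le> y" "h r = v"
      using IVT'[of h z v y] by blast
    then show ?thesis using z y by force
  qed
  show "\<exists>r\<in>{x<..<b}. sin (h r) = 0"
    using hits[of "real k * pi"] by force
  show "\<exists>r\<in>{x<..<b}. cos (h r) = 0"
    using hits[of "real k * pi + pi/2"] by (force simp: cos_add)
qed

text \<open>
  Beyond every point there are parameters \<open>r1 < r2\<close> with \<open>\<tau> r1 = -2\<close> and \<open>\<tau> r2 = 2\<close>.  Between them \<open>\<tau>\<close> has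
  a zero \<open>q\<close>, and \<open>|\<tau>| < 2\<close> holds on an interval \<open>(q, s)\<close> next to it.  Iterating this yields triples
  \<open>r1 < q < s\<close>, each lying beyond the previous one; the sequence consists of the \<open>q\<close> (odd indices) and
  the \<open>s\<close> (even indices), and \<open>r1\<close> of the next triple is the unstable parameter in the gap.
\<close>

lemma alternating_intervals:
  fixes S :: "real \<Rightarrow> bool" and \<tau> :: "real \<Rightarrow> real"
  assumes "0 < b" and cont: "continuous_on {0<..<b} \<tau>"
    and S: "\<And>r. r \<in> {0<..<b} \<Longrightarrow> \<bar>\<tau> r\<bar> < 2 \<Longrightarrow> S r"
    and notS: "\<And>r. r \<in> {0<..<b} \<Longrightarrow> \<bar>\<tau> r\<bar> = 2 \<Longrightarrow> \<not> S r"
    and low: "\<And>x. x \<in> {0<..<b} \<Longrightarrow> \<exists>r\<in>{x<..<b}. \<tau> r = - 2"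
    and high: "\<And>x. x \<in> {0<..<b} \<Longrightarrow> \<exists>r\<in>{x<..<b}. \<tau> r = 2"
  shows "\<exists>r :: nat \<Rightarrow> real.
            (\<forall>n. 0 < r n \<and> r n < b)
          \<and> (\<forall>n. r (2 * n) \<le> r (2 * n + 1) \<and> r (2 * n + 1) < r (2 * n + 2))
          \<and> r \<longlonglongrightarrow> b
          \<and> (\<forall>n\<ge>1. \<forall>s \<in> {r (2 * n - 1)<..<r (2 * n)}. S s)
          \<and> (\<forall>n. \<exists>s \<in> {r (2 * n)..r (2 * n + 1)}. \<not> S s)"
proof -
  define good where "good x p \<longleftrightarrow> x < fst p \<and> 0 < fst p \<and> fst p < fst (snd p) \<and> fst (snd p) < snd (snd p)
      \<and> snd (snd p) < b \<and> \<not> S (fst p) \<and> (\<forall>z\<in>{fst (snd p)<..<snd (snd p)}. S z)"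
    for x and p :: "real \<times> real \<times> real"
  have step: "\<exists>p. good x p" if "x < b" for x
  proof -
    define x0 where "x0 = (max x 0 + b) / 2"
    have x0: "x < x0" "x0 \<in> {0<..<b}" using that \<open>0 < b\<close> by (auto simp: x0_def)
    obtain r1 where r1: "r1 \<in> {x0<..<b}" "\<tau> r1 = - 2" using low[OF x0(2)] by blast
    then have r1': "r1 \<in> {0<..<b}" using x0 by auto
    obtain r2 where r2: "r2 \<in> {r1<..<b}" "\<tau> r2 = 2" using high[OF r1'] by blast
    have "continuous_on {r1..r2} \<tau>"
      by (rule continuous_on_subset[OF cont]) (use r1' r2 in auto)
    then obtain q where q: "r1 \<le> q" "q \<le> r2" "\<tau> q = 0"
      using IVT'[of \<tau> r1 0 r2] r1 r2 by auto
    then have q': "q \<in> {r1<..<r2}" using r1 r2 by (cases "q = r1"; cases "q = r2") auto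
    then have "isCont \<tau> q"
      using cont r1' r2 by (simp add: continuous_on_eq_continuous_at)
    then have "\<forall>\<^sub>F z in at q. dist (\<tau> z) (\<tau> q) < 2"
      by (intro tendstoD) (simp_all add: isCont_def)
    then obtain e where e: "0 < e" "\<And>z. z \<noteq> q \<Longrightarrow> dist z q < e \<Longrightarrow> dist (\<tau> z) (\<tau> q) < 2"
      by (auto simp: eventually_at)
    define s where "s = min (q + e) r2"
    have "S z" if "z \<in> {q<..<s}" for z
      using that e(2)[of z] q q' r1' r2 by (intro S) (auto simp: s_def dist_real_def)
    moreover have "q < s" "s < b" using e(1) q' r2 by (auto simp: s_def)
    moreover have "\<not> S r1" using notS[OF r1'] r1 by simp
    ultimately have "good x (r1, q, s)"
      using x0 r1 r1' q' by (auto simp: good_def)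
    then show ?thesis by blast
  qed
  \<comment> \<open>Pushing the \<open>n\<close>-th triple beyond \<open>target n\<close> forces convergence to \<open>b\<close>.\<close>
  define target where "target n = b - 1 / (real n + 1)" for n
  have "\<exists>f. \<forall>n. good (target n) (f n) \<and> snd (snd (f n)) < fst (f (Suc n))"
  proof (rule dependent_nat_choice)
    show "\<exists>p. good (target 0) p" by (rule step) (simp add: target_def)
    fix p n assume p: "good (target n) p"
    have "max (target (Suc n)) (snd (snd p)) < b" using p by (simp add: target_def good_def)
    then obtain p' where "good (max (target (Suc n)) (snd (snd p))) p'" using step by blast
    then have "good (target (Suc n)) p'" "snd (snd p) < fst p'" by (auto simp: good_def)
    then show "\<exists>p'. good (target (Suc n)) p' \<and> snd (snd p) < fst p'" by blast
  qed
  then obtain f where f: "\<And>n. good (target n) (f n)" "\<And>n. snd (snd (f n)) < fst (f (Suc n))" by blast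
  define r where "r k = (if odd k then fst (snd (f (k div 2)))
      else if k = 0 then fst (f 0) else snd (snd (f (k div 2 - 1))))" for k
  have r_odd: "r (2 * n + 1) = fst (snd (f n))" for n by (simp add: r_def)
  have r_even: "r (2 * n + 2) = snd (snd (f n))" for n by (simp add: r_def)
  have r_0: "r 0 = fst (f 0)" by (simp add: r_def)
  have gap: "r (2 * n) \<le> fst (f n)" for n
  proof (cases n)
    case (Suc m)
    then show ?thesis using r_even[of m] f(2)[of m] by simp
  qed (simp add: r_0)
  have range: "target n < fst (f n) \<and> 0 < fst (f n) \<and> fst (f n) < fst (snd (f n))
      \<and> fst (snd (f n)) < snd (snd (f n)) \<and> snd (snd (f n)) < b" for n
    using f(1)[of n] by (simp add: good_def)
  have in_range: "0 < r k \<and> r k < b" for k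
  proof (cases "odd k")
    case True
    then obtain n where "k = 2 * n + 1" by (rule oddE)
    then show ?thesis using range[of n] r_odd[of n] by auto
  next
    case False
    then obtain n where n: "k = 2 * n" by (auto elim: evenE)
    show ?thesis
    proof (cases n)
      case 0
      then show ?thesis using n range[of 0] r_0 by auto
    next
      case (Suc m)
      then show ?thesis using n range[of m] r_even[of m] by auto
    qed
  qed
  have below: "b - 2 / real k \<le> r k" if "k > 0" for k
  proof (cases "odd k")
    case True
    then obtain n where n: "k = 2 * n + 1" by (rule oddE)
    have "1 / (real n + 1) \<le> 2 / real k" using n by (simp add: field_simps)
    then show ?thesis using n range[of n] r_odd[of n] by (simp add: target_def)
  next
    case False
    then obtain j where j: "k = 2 * j" by (auto elim: evenE)
    then obtain m where "j = Suc m" using \<open>k > 0\<close> by (cases j) auto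
    then have m: "k = 2 * m + 2" using j by simp
    have "1 / (real m + 1) \<le> 2 / real k" using m by (simp add: field_simps)
    then show ?thesis using m range[of m] r_even[of m] by (simp add: target_def)
  qed
  have "r \<longlonglongrightarrow> b"
  proof (rule tendsto_sandwich)
    show "(\<lambda>k. b - 2 / real k) \<longlonglongrightarrow> b"
      using tendsto_diff[OF tendsto_const lim_const_over_n[of 2]] by simp
    show "\<forall>\<^sub>F k in sequentially. b - 2 / real k \<le> r k"
      using below by (auto intro: eventually_mono[OF eventually_gt_at_top[of 0]])
    show "\<forall>\<^sub>F k in sequentially. r k \<le> b" using in_range by (simp add: less_imp_le)
  qed simp
  moreover have "r (2 * n) \<le> r (2 * n + 1) \<and> r (2 * n + 1) < r (2 * n + 2)" for n
    using gap[of n] range[of n] r_odd[of n] r_even[of n] by auto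
  moreover have "S s" if "n \<ge> 1" "s \<in> {r (2 * n - 1)<..<r (2 * n)}" for n s
  proof -
    from \<open>n \<ge> 1\<close> obtain m where "n = m + 1" by (cases n) auto
    then show ?thesis using that(2) f(1)[of m] r_odd[of m] r_even[of m] by (simp add: good_def)
  qed
  moreover have "\<exists>s \<in> {r (2 * n)..r (2 * n + 1)}. \<not> S s" for n
    using f(1)[of n] gap[of n] range[of n] r_odd[of n] by (intro bexI[of _ "fst (f n)"]) (auto simp: good_def)
  ultimately show ?thesis using in_range by blast
qed

section \<open>Infinitely many stability changes\<close>

text \<open>
  Here \<open>x, y = x'\<close> and \<open>u, v = u'\<close> are the columns of the fundamental matrix, \<open>\<theta> r t\<close> is the scaled Pruefer
  angle of \<open>(x, y)\<close>, and its continuity and unboundedness in \<open>r\<close> at \<open>t = \<pi>\<close> produce the zeros of \<open>x(\<pi>)\<close>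
  and \<open>y(\<pi>)\<close>.
\<close>

lemma hill_trace_oscillates:
  assumes ecc: "0 \<le> \<epsilon>" "\<epsilon> < 1"
  obtains \<tau> :: "real \<Rightarrow> real" where "continuous_on {0<..<2 / (1 + \<epsilon>)} \<tau>"
    and "\<And>r. r \<in> {0<..<2 / (1 + \<epsilon>)} \<Longrightarrow> \<bar>\<tau> r\<bar> < 2 \<Longrightarrow> strongly_stable (linearization_matrix \<epsilon> r) (2 * pi)"
    and "\<And>r. r \<in> {0<..<2 / (1 + \<epsilon>)} \<Longrightarrow> \<bar>\<tau> r\<bar> = 2 \<Longrightarrow> \<not> strongly_stable (linearization_matrix \<epsilon> r) (2 * pi)"
    and "\<And>s. s \<in> {0<..<2 / (1 + \<epsilon>)} \<Longrightarrow> \<exists>r\<in>{s<..<2 / (1 + \<epsilon>)}. \<tau> r = - 2"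
    and "\<And>s. s \<in> {0<..<2 / (1 + \<epsilon>)} \<Longrightarrow> \<exists>r\<in>{s<..<2 / (1 + \<epsilon>)}. \<tau> r = 2"
proof -
  define I where "I = {0<..<2 / (1 + \<epsilon>)}"
  define \<delta> where "\<delta> r = 2 - r * (1 + \<epsilon>)" for r
  define g where "g = hill_coefficient \<epsilon>"
  have \<delta>: "0 < \<delta> r" if "r \<in> I" for r
    using gap_pos[OF ecc, of r] that by (simp add: \<delta>_def I_def)
  have \<delta>_cont: "continuous_on I \<delta>"
    unfolding \<delta>_def by (intro continuous_intros)
  have c: "0 < 2 / (1 + \<epsilon>)" using ecc by simp
  have g_cont: "continuous_on (I \<times> UNIV) (\<lambda>(r, t). g r t)"
    unfolding I_def g_def by (rule continuous_on_hill_coefficient[OF ecc])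
  have K_cont: "continuous_on I (\<lambda>r. 6 / \<delta> r ^ 3)"
    by (intro continuous_intros \<delta>_cont) (use \<delta> in force)
  have K: "\<bar>g r t\<bar> \<le> 6 / \<delta> r ^ 3" if "r \<in> I" for r t
    using abs_hill_coefficient_le[OF ecc, of r t] that by (simp add: g_def \<delta>_def I_def)
  note solve = second_order_solution_on_interval[OF c g_cont[unfolded I_def] K_cont[unfolded I_def]
      K[unfolded I_def], folded I_def]
  obtain x y where x0: "\<And>r. r \<in> I \<Longrightarrow> x r 0 = 1" and y0: "\<And>r. r \<in> I \<Longrightarrow> y r 0 = 0"
    and x': "\<And>r t. r \<in> I \<Longrightarrow> (x r has_real_derivative y r t) (at t)"
    and y': "\<And>r t. r \<in> I \<Longrightarrow> (y r has_real_derivative g r t * x r t) (at t)"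
    and x_cont: "continuous_on (I \<times> UNIV) (\<lambda>(r, t). x r t)"
    and y_cont: "continuous_on (I \<times> UNIV) (\<lambda>(r, t). y r t)"
    using solve[of 1 0] by blast
  obtain u v where u0: "\<And>r. r \<in> I \<Longrightarrow> u r 0 = 0" and v0: "\<And>r. r \<in> I \<Longrightarrow> v r 0 = 1"
    and u': "\<And>r t. r \<in> I \<Longrightarrow> (u r has_real_derivative v r t) (at t)"
    and v': "\<And>r t. r \<in> I \<Longrightarrow> (v r has_real_derivative g r t * u r t) (at t)"
    and u_cont: "continuous_on (I \<times> UNIV) (\<lambda>(r, t). u r t)"
    and v_cont: "continuous_on (I \<times> UNIV) (\<lambda>(r, t). v r t)"
    using solve[of 0 1] by blast
  define X :: "real \<Rightarrow> real \<Rightarrow> real ^ 2 ^ 2"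
    where "X r t = vector [vector [x r t, u r t], vector [y r t, v r t]]" for r t
  have X: "fundamental_matrix (hill_matrix (g r)) (X r)" if "r \<in> I" for r
    using fundamental_matrix_hillI[OF x' y' u' v' x0 y0 u0 v0, OF that that that that that that that that]
    by (simp add: X_def[abs_def])
  have det: "x r t * v r t - y r t * u r t = 1" if "r \<in> I" for r t
    using hill_determinant[OF X[OF that], of t] by (simp add: X_def)
  have nz: "x r t \<noteq> 0 \<or> y r t \<noteq> 0" if "r \<in> I" for r t
    using det[OF that, of t] by auto
  define \<tau> where "\<tau> r = 2 * (x r pi * v r pi + u r pi * y r pi)" for r
  have trace: "trace (X r (2 * pi)) = \<tau> r" if "r \<in> I" for r
    using hill_trace_symmetric[OF X[OF that], of pi] hill_coefficient_reflect[OF ecc, of r] that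
    by (simp add: g_def I_def trace_def sum_2 \<tau>_def X_def)
  have at_pi: "continuous_on I (\<lambda>r. h r pi)" if "continuous_on (I \<times> UNIV) (\<lambda>(r, t). h r t)"
    for h :: "real \<Rightarrow> real \<Rightarrow> real"
  proof -
    have "continuous_on I (\<lambda>r. (r, pi))" by (intro continuous_intros)
    from continuous_on_compose2[OF that this] show ?thesis by auto
  qed
  have \<tau>_cont: "continuous_on I \<tau>"
    unfolding \<tau>_def by (intro continuous_intros at_pi x_cont y_cont u_cont v_cont)
  define C where "C = 7 + 2 / (1 - \<epsilon>)"
  have C: "0 < C" using ecc by (simp add: C_def add_pos_nonneg)
  \<comment> \<open>\<open>C \<delta>\<close> bounds the distance to the first primary for \<open>|t - \<pi>| \<le> \<delta>\<close>, and \<open>\<omega>\<^sup>2\<close> is the resulting lower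
     bound for the attraction.\<close>
  define \<omega> where "\<omega> r = sqrt (1 / (4 * (C * \<delta> r) ^ 3))" for r
  have \<omega>: "0 < \<omega> r" if "r \<in> I" for r using \<delta>[OF that] C by (simp add: \<omega>_def)
  have \<omega>_cont: "continuous_on I \<omega>"
    unfolding \<omega>_def by (intro continuous_intros \<delta>_cont) (use \<delta> C in force)
  define F where "F r t = pruefer_speed (\<omega> r) (g r t) (x r t) (y r t)" for r t
  have F_cont: "continuous_on A (\<lambda>p. F (h p) (k p))"
    if h: "continuous_on A h" and k: "continuous_on A k" and hI: "\<And>p. p \<in> A \<Longrightarrow> h p \<in> I"
    for A k and h :: "'b::topological_space \<Rightarrow> real"
  proof -
    have pair: "continuous_on A (\<lambda>p. (h p, k p))" by (intro continuous_on_Pair h k)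
    have comp: "continuous_on A (\<lambda>p. f (h p) (k p))"
      if "continuous_on (I \<times> UNIV) (\<lambda>(r, t). f r t)" for f :: "real \<Rightarrow> real \<Rightarrow> real"
      using continuous_on_compose2[OF that pair] hI by auto
    have \<omega>h: "continuous_on A (\<lambda>p. \<omega> (h p))"
      by (rule continuous_on_compose2[OF \<omega>_cont h]) (use hI in auto)
    have "(\<omega> (h p))\<^sup>2 * (x (h p) (k p))\<^sup>2 + (y (h p) (k p))\<^sup>2 \<noteq> 0" if "p \<in> A" for p
      using nz[OF hI[OF that], of "k p"] \<omega>[OF hI[OF that]]
      by (simp add: sum_power2_eq_zero_iff flip: power_mult_distrib)
    then show ?thesis
      unfolding F_def pruefer_speed_def
      by (intro continuous_intros \<omega>h comp x_cont y_cont g_cont) auto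
  qed
  \<comment> \<open>The Pruefer angle is defined as the integral of its speed over \<open>[0, t]\<close>, so no branch of the
     argument has to be chosen and continuity in \<open>r\<close> is that of a parameter integral.\<close>
  define \<theta> where "\<theta> r t = t *\<^sub>R integral {0..1} (\<lambda>\<sigma>. F r (t * \<sigma>))" for r t
  have \<theta>': "(\<theta> r has_real_derivative pruefer_speed (\<omega> r) (g r t) (x r t) (y r t)) (at t)" if "r \<in> I" for r t
  proof -
    have "continuous_on UNIV (F r)"
      by (rule F_cont) (use that in \<open>auto intro!: continuous_intros\<close>)
    from scaled_integral_has_vector_derivative[OF this, of t] show ?thesis
      by (simp add: \<theta>_def[abs_def] F_def has_real_derivative_iff_has_vector_derivative)
  qed
  have \<theta>_cont: "continuous_on I (\<lambda>r. \<theta> r pi)"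
  proof -
    have "continuous_on I (\<lambda>r. integral (cbox 0 1) (\<lambda>\<sigma>. F r (pi * \<sigma>)))"
      unfolding case_prod_beta
      by (intro integral_continuous_on_param, unfold case_prod_beta, rule F_cont)
         (auto intro!: continuous_intros)
    then show ?thesis
      unfolding \<theta>_def by (intro continuous_intros) simp
  qed
  have direction: "\<omega> r * x r pi * sin (\<theta> r pi) + y r pi * cos (\<theta> r pi) = 0" if "r \<in> I" for r
    by (rule pruefer_angle_direction[OF x'[OF that] y'[OF that] \<theta>'[OF that] y0[OF that] _ nz[OF that]])
       (use \<omega>[OF that] in \<open>auto simp: \<theta>_def\<close>)
  have unbounded: "\<exists>r\<in>{s<..<2 / (1 + \<epsilon>)}. B \<le> \<theta> r pi" if s: "s \<in> {0<..<2 / (1 + \<epsilon>)}" for B s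
  proof -
    define B' where "B' = \<bar>B\<bar> + 2 * pi"
    have B': "0 < B'" by (simp add: B'_def add_nonneg_pos)
    \<comment> \<open>The three bounds make \<open>r > s\<close>, the distance bound \<open>C d\<close> at most \<open>1/2\<close>, and the gain \<open>d \<omega>\<close>, whose
       square is \<open>1 / (4 C\<^sup>3 d)\<close>, at least \<open>B'\<close>; the latter includes the possible loss of \<open>2\<pi>\<close>.\<close>
    define d where "d = Min {\<delta> s / 2, 1 / (2 * C), 1 / (4 * C ^ 3 * B'\<^sup>2)}"
    have d: "0 < d" "d \<le> \<delta> s / 2" "d \<le> 1 / (2 * C)" "d \<le> 1 / (4 * C ^ 3 * B'\<^sup>2)"
      using \<delta>[of s] s C B' by (auto simp: d_def I_def)
    define r where "r = (2 - d) / (1 + \<epsilon>)"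
    have \<delta>r: "\<delta> r = d" using ecc by (simp add: \<delta>_def r_def)
    have "(1 + \<epsilon>) * s < (1 + \<epsilon>) * r"
      using d \<delta>[of s] s \<delta>r by (simp add: \<delta>_def I_def mult.commute)
    then have sr: "s < r" using ecc by simp
    have "r < 2 / (1 + \<epsilon>)"
      unfolding r_def using d ecc by (intro divide_strict_right_mono) auto
    then have r: "r \<in> {s<..<2 / (1 + \<epsilon>)}" "r \<in> I" "0 < r" "r < 2 / (1 + \<epsilon>)" using sr s by (auto simp: I_def)
    have w: "C * d \<le> 1/2" "0 < C * d" using d(1,3) C by (simp_all add: field_simps)
    have \<omega>2: "(\<omega> r)\<^sup>2 = 1 / (4 * (C * d) ^ 3)"
      using w by (simp add: \<omega>_def \<delta>r)
    have "0 < s * (1 + \<epsilon>)" using s ecc by simp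
    then have "\<delta> s < 2" unfolding \<delta>_def by (simp only: diff_less_eq less_add_same_cancel1)
    then have "d \<le> 1" using d(2) by linarith
    have "d * \<omega> r - 2 * pi / \<omega> r \<le> \<theta> r pi"
    proof (rule pruefer_angle_lower_bound[OF \<theta>'[OF r(2)] _ nz[OF r(2)] \<omega>[OF r(2)]])
      show "g r t \<le> 2" for t
        unfolding g_def by (rule hill_coefficient_le_2[OF ecc r(3,4)])
      show "d \<le> pi" using \<open>d \<le> 1\<close> pi_gt3 by linarith
      show "g r t \<le> - (\<omega> r)\<^sup>2" if "t \<in> {pi - d..pi}" for t
        using hill_coefficient_near_apoapsis[OF ecc r(3,4), of t "C * d"] that w(1)
        unfolding g_def \<omega>2 by (auto simp: C_def \<delta>r[unfolded \<delta>_def])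
    qed (use d in \<open>auto simp: \<theta>_def\<close>)
    moreover have "2 * pi / \<omega> r \<le> 2 * pi"
    proof -
      have "(C * d) ^ 3 \<le> (1/2) ^ 3" using w by (intro power_mono) auto
      moreover have "(1/2 :: real) ^ 3 = 1/8" by (simp add: power3_eq_cube)
      ultimately have "4 * (C * d) ^ 3 \<le> 1" by linarith
      then have "1 \<le> 1 / (4 * (C * d) ^ 3)"
        using zero_less_power[OF w(2), of 3] by (subst le_divide_eq_1_pos) simp_all
      then have "1 \<le> \<omega> r" by (simp add: \<omega>_def \<delta>r)
      then show ?thesis by (simp add: field_simps)
    qed
    moreover have "B' \<le> d * \<omega> r"
    proof -
      have "B'\<^sup>2 \<le> 1 / (4 * C ^ 3 * d)"
        using d(1,4) C B' by (simp add: field_simps)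
      also have "\<dots> = (d * \<omega> r)\<^sup>2"
        using d(1) C unfolding power_mult_distrib \<omega>2 by (simp add: field_simps power2_eq_square power3_eq_cube)
      finally show ?thesis using B' d(1) \<omega>[OF r(2)] by (simp add: power2_le_iff_abs_le)
    qed
    ultimately have "B \<le> \<theta> r pi" by (simp add: B'_def)
    then show ?thesis using r(1) by blast
  qed
  note hits = unbounded_angle_hits[OF \<theta>_cont[unfolded I_def] _ unbounded]
  show ?thesis
  proof (rule that[of \<tau>])
    show "continuous_on {0<..<2 / (1 + \<epsilon>)} \<tau>" using \<tau>_cont by (simp add: I_def)
  next
    fix r assume r: "r \<in> {0<..<2 / (1 + \<epsilon>)}"
    then have lin: "linearization_matrix \<epsilon> r = hill_matrix (g r)"
      using linearization_matrix_eq[OF ecc, of r] by (simp add: g_def)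
    have rI: "r \<in> I" using r by (simp add: I_def)
    show "strongly_stable (linearization_matrix \<epsilon> r) (2 * pi)" if "\<bar>\<tau> r\<bar> < 2"
      unfolding lin by (rule hill_strongly_stableI[OF X[OF rI]]) (simp add: trace[OF rI] that)
    show "\<not> strongly_stable (linearization_matrix \<epsilon> r) (2 * pi)" if "\<bar>\<tau> r\<bar> = 2"
      unfolding lin by (rule hill_not_strongly_stableI[OF X[OF rI]]) (simp add: trace[OF rI] that)
  next
    fix s assume s: "s \<in> {0<..<2 / (1 + \<epsilon>)}"
    obtain r where r: "r \<in> {s<..<2 / (1 + \<epsilon>)}" "cos (\<theta> r pi) = 0"
      using hits(2)[OF s] by blast
    have rI: "r \<in> I" using r s by (auto simp: I_def)
    have "sin (\<theta> r pi) \<noteq> 0" using r(2) sin_cos_squared_add[of "\<theta> r pi"] by auto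
    then have "x r pi = 0" using direction[OF rI] \<omega>[OF rI] r(2) by simp
    then have "\<tau> r = - 2" using det[OF rI, of pi] by (simp add: \<tau>_def mult.commute)
    then show "\<exists>r\<in>{s<..<2 / (1 + \<epsilon>)}. \<tau> r = - 2" using r(1) by blast
  next
    fix s assume s: "s \<in> {0<..<2 / (1 + \<epsilon>)}"
    obtain r where r: "r \<in> {s<..<2 / (1 + \<epsilon>)}" "sin (\<theta> r pi) = 0"
      using hits(1)[OF s] by blast
    have rI: "r \<in> I" using r s by (auto simp: I_def)
    have "cos (\<theta> r pi) \<noteq> 0" using r(2) sin_cos_squared_add[of "\<theta> r pi"] by auto
    then have "y r pi = 0" using direction[OF rI] r(2) by simp
    then have "\<tau> r = 2" using det[OF rI, of pi] by (simp add: \<tau>_def)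
    then show "\<exists>r\<in>{s<..<2 / (1 + \<epsilon>)}. \<tau> r = 2" using r(1) by blast
  qed
qed

theorem theorem7:
  fixes \<epsilon> :: real
  assumes "0 \<le> \<epsilon>" and "\<epsilon> < 1"
  shows "(\<exists>x \<in> {primary1 \<epsilon>, primary2 \<epsilon>}.
            ((\<lambda>s. setdist (range (x s)) particle_circle) \<longlongrightarrow> 0) (at_left (2 / (1 + \<epsilon>))))
       \<and> (\<exists>r :: nat \<Rightarrow> real.
            (\<forall>n. 0 < r n \<and> r n < 2 / (1 + \<epsilon>))
          \<and> (\<forall>n. r (2 * n) \<le> r (2 * n + 1) \<and> r (2 * n + 1) < r (2 * n + 2))
          \<and> r \<longlonglongrightarrow> 2 / (1 + \<epsilon>)
          \<and> (\<forall>n\<ge>1. \<forall>s \<in> {r (2 * n - 1)<..<r (2 * n)}.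
                strongly_stable (linearization_matrix \<epsilon> s) (2 * pi))
          \<and> (\<forall>n. \<exists>s \<in> {r (2 * n)..r (2 * n + 1)}.
                \<not> strongly_stable (linearization_matrix \<epsilon> s) (2 * pi)))"
proof
  show "\<exists>x \<in> {primary1 \<epsilon>, primary2 \<epsilon>}.
      ((\<lambda>s. setdist (range (x s)) particle_circle) \<longlongrightarrow> 0) (at_left (2 / (1 + \<epsilon>)))"
    using collision_distance_tendsto_0[OF assms] by blast
  obtain \<tau> :: "real \<Rightarrow> real" where "continuous_on {0<..<2 / (1 + \<epsilon>)} \<tau>"
    and "\<And>r. r \<in> {0<..<2 / (1 + \<epsilon>)} \<Longrightarrow> \<bar>\<tau> r\<bar> < 2 \<Longrightarrow> strongly_stable (linearization_matrix \<epsilon> r) (2 * pi)"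
    and "\<And>r. r \<in> {0<..<2 / (1 + \<epsilon>)} \<Longrightarrow> \<bar>\<tau> r\<bar> = 2 \<Longrightarrow> \<not> strongly_stable (linearization_matrix \<epsilon> r) (2 * pi)"
    and "\<And>s. s \<in> {0<..<2 / (1 + \<epsilon>)} \<Longrightarrow> \<exists>r\<in>{s<..<2 / (1 + \<epsilon>)}. \<tau> r = - 2"
    and "\<And>s. s \<in> {0<..<2 / (1 + \<epsilon>)} \<Longrightarrow> \<exists>r\<in>{s<..<2 / (1 + \<epsilon>)}. \<tau> r = 2"
    using hill_trace_oscillates[OF assms] by blast
  then show "\<exists>r :: nat \<Rightarrow> real.
            (\<forall>n. 0 < r n \<and> r n < 2 / (1 + \<epsilon>))
          \<and> (\<forall>n. r (2 * n) \<le> r (2 * n + 1) \<and> r (2 * n + 1) < r (2 * n + 2))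
          \<and> r \<longlonglongrightarrow> 2 / (1 + \<epsilon>)
          \<and> (\<forall>n\<ge>1. \<forall>s \<in> {r (2 * n - 1)<..<r (2 * n)}.
                strongly_stable (linearization_matrix \<epsilon> s) (2 * pi))
          \<and> (\<forall>n. \<exists>s \<in> {r (2 * n)..r (2 * n + 1)}.
                \<not> strongly_stable (linearization_matrix \<epsilon> s) (2 * pi))"
    using assms by (intro alternating_intervals[of "2 / (1 + \<epsilon>)" \<tau>]) simp_all
qed

end
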